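(* Let $A$ be an infinite dimensional simple unital C*-algebra, and let $B \subset A$ be a large subalgebra. Then the restriction map $\operatorname{T}(A) \to \operatorname{T}(B)$, $\tau \mapsto \tau|_B$, is bijective.
   Context: $\operatorname{T}(D)$ denotes the set of tracial states on a unital C*-algebra $D$. Subalgebras are C*-subalgebras; a unital subalgebra of $A$ contains the identity of $A$. For a C*-algebra $D$ and $a, b \in D_{+}$ (positive elements), $a \precsim_D b$ (Cuntz subequivalence) means there is a sequence $(v_n)$ in $D$ with $\lim_{n \to \infty} v_n b v_n^* = a$. Large subalgebra: let $A$ be an infinite dimensional simple unital C*-algebra. A unital subalgebra $B \subset A$ is large in $A$ if for every integer $m \geq 1$, $a_1, \ldots, a_m \in A$, $\varepsilon > 0$, $x \in A_{+}$ with $\|x\| = 1$, and $y \in B_{+} \setminus \{0\}$, there are $c_1, \ldots, c_m \in A$ and $g \in B$ such that: (1) $0 \leq g \leq 1$; (2) $\|c_j - a_j\| < \varepsilon$ for $j = 1, \ldots, m$; (3) $(1-g) c_j \in B$ for $j = 1, \ldots, m$; (4) $g \precsim_B y$ and $g \precsim_A x$; (5) $\|(1-g) x (1-g)\| > 1 - \varepsilon$. *)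

theory Defs
  imports "HOL-Analysis.Analysis"
begin

text \<open>Unital complex C*-algebras. The complex scalar multiplication \<open>scaleC\<close> extends the real one
  inherited from \<^class>\<open>real_normed_algebra_1\<close>. That class also gives \<open>norm 1 = 1\<close>, so that the
  zero algebra is excluded.\<close>

class unital_cstar_algebra = real_normed_algebra_1 + complete_space +
  fixes scaleC :: "complex \<Rightarrow> 'a \<Rightarrow> 'a"  (infixr "*\<^sub>C" 75)
    and adj :: "'a \<Rightarrow> 'a"
  assumes scaleR_scaleC: "r *\<^sub>R x = complex_of_real r *\<^sub>C x"
    and scaleC_add_right: "c *\<^sub>C (x + y) = c *\<^sub>C x + c *\<^sub>C y"
    and scaleC_add_left: "(c + d) *\<^sub>C x = c *\<^sub>C x + d *\<^sub>C x"
    and scaleC_scaleC: "c *\<^sub>C d *\<^sub>C x = (c * d) *\<^sub>C x"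
    and scaleC_one: "1 *\<^sub>C x = x"
    and mult_scaleC_left: "(c *\<^sub>C x) * y = c *\<^sub>C (x * y)"
    and mult_scaleC_right: "x * (c *\<^sub>C y) = c *\<^sub>C (x * y)"
    and norm_scaleC: "norm (c *\<^sub>C x) = cmod c * norm x"
    and adj_adj: "adj (adj x) = x"
    and adj_add: "adj (x + y) = adj x + adj y"
    and adj_scaleC: "adj (c *\<^sub>C x) = cnj c *\<^sub>C adj x"
    and adj_mult: "adj (x * y) = adj y * adj x"
    and cstar_identity: "norm (adj x * x) = (norm x)\<^sup>2"

interpretation cstar_space: vector_space "scaleC :: complex \<Rightarrow> 'a \<Rightarrow> 'a::unital_cstar_algebra"
  by standard (simp_all add: scaleC_add_right scaleC_add_left scaleC_scaleC scaleC_one)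

text \<open>Properties of a whole algebra are predicates on the type, the type being the algebra.\<close>

definition infinite_dimensional :: "'a::unital_cstar_algebra itself \<Rightarrow> bool" where
  "infinite_dimensional _ \<longleftrightarrow> (\<nexists>S :: 'a set. finite S \<and> cstar_space.span S = UNIV)"

definition closed_two_sided_ideal :: "'a::unital_cstar_algebra set \<Rightarrow> bool" where
  "closed_two_sided_ideal I \<longleftrightarrow>
     closed I \<and> cstar_space.subspace I \<and> (\<forall>x\<in>I. \<forall>a. a * x \<in> I \<and> x * a \<in> I)"

definition simple_algebra :: "'a::unital_cstar_algebra itself \<Rightarrow> bool" where
  "simple_algebra _ \<longleftrightarrow> (\<forall>I :: 'a set. closed_two_sided_ideal I \<longrightarrow> I = {0} \<or> I = UNIV)"

definition unital_subalgebra :: "'a::unital_cstar_algebra set \<Rightarrow> bool" where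
  "unital_subalgebra D \<longleftrightarrow>
     closed D \<and> cstar_space.subspace D \<and> 1 \<in> D \<and>
     (\<forall>x\<in>D. \<forall>y\<in>D. x * y \<in> D) \<and> (\<forall>x\<in>D. adj x \<in> D)"

text \<open>The notions below are relative to a C*-subalgebra \<open>D\<close>; for the whole algebra take
  \<open>D = UNIV\<close>.\<close>

text \<open>The positive elements of a C*-algebra are those of the form \<open>adj b * b\<close>. For a C*-subalgebra
  \<open>D\<close> they coincide with the positive elements of the ambient algebra that lie in \<open>D\<close>.\<close>

definition positives :: "'a::unital_cstar_algebra set \<Rightarrow> 'a set" where
  "positives D = {adj b * b | b. b \<in> D}"

definition cstar_le :: "'a::unital_cstar_algebra set \<Rightarrow> 'a \<Rightarrow> 'a \<Rightarrow> bool" where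
  "cstar_le D a b \<longleftrightarrow> b - a \<in> positives D"

definition cuntz_subequiv :: "'a::unital_cstar_algebra set \<Rightarrow> 'a \<Rightarrow> 'a \<Rightarrow> bool" where
  "cuntz_subequiv D a b \<longleftrightarrow>
     (\<exists>v :: nat \<Rightarrow> 'a. (\<forall>n. v n \<in> D) \<and> (\<lambda>n. v n * b * adj (v n)) \<longlonglongrightarrow> a)"

text \<open>Functionals on \<open>D\<close> are total functions on the ambient type; requiring them to be
  \<^const>\<open>extensional\<close> (that is, \<^const>\<open>undefined\<close> off \<open>D\<close>) makes equality of functions agree with
  equality on \<open>D\<close>.\<close>

definition tracial_states :: "'a::unital_cstar_algebra set \<Rightarrow> ('a \<Rightarrow> complex) set" where
  "tracial_states D = {\<tau> \<in> extensional D.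
     (\<forall>x\<in>D. \<forall>y\<in>D. \<tau> (x + y) = \<tau> x + \<tau> y) \<and>
     (\<forall>c. \<forall>x\<in>D. \<tau> (c *\<^sub>C x) = c * \<tau> x) \<and>
     (\<forall>x \<in> positives D. \<tau> x \<in> \<real>\<^sub>\<ge>\<^sub>0) \<and>
     \<tau> 1 = 1 \<and>
     (\<forall>x\<in>D. \<forall>y\<in>D. \<tau> (x * y) = \<tau> (y * x))}"

definition large_subalgebra :: "'a::unital_cstar_algebra set \<Rightarrow> bool" where
  "large_subalgebra B \<longleftrightarrow> unital_subalgebra B \<and>
     (\<forall>(m::nat) (a :: nat \<Rightarrow> 'a) (\<epsilon>::real) x y.
        m \<ge> 1 \<and> \<epsilon> > 0 \<and> x \<in> positives UNIV \<and> norm x = 1 \<and> y \<in> positives B - {0} \<longrightarrow>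
        (\<exists>(c :: nat \<Rightarrow> 'a) g. g \<in> B \<and>
           cstar_le B 0 g \<and> cstar_le B g 1 \<and>
           (\<forall>j\<in>{1..m}. norm (c j - a j) < \<epsilon>) \<and>
           (\<forall>j\<in>{1..m}. (1 - g) * c j \<in> B) \<and>
           cuntz_subequiv B g y \<and> cuntz_subequiv UNIV g x \<and>
           norm ((1 - g) * x * (1 - g)) > 1 - \<epsilon>))"

end

theory Submission
  imports Defs
begin

text \<open>Let \<open>\<tau>\<close> be a trace on \<open>B\<close>. If \<open>g \<in> B\<close>, \<open>0 \<le> g \<le> 1\<close> and \<open>\<tau>(g)\<close> is small, then \<open>a\<close> and \<open>(1 - g) a\<close> have almost
  the same value under any trace that extends \<open>\<tau>\<close>, by Cauchy--Schwarz; largeness makes \<open>(1 - g) c\<close> an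
  element of \<open>B\<close> for some \<open>c\<close> close to \<open>a\<close>. This gives injectivity, and it also defines the extension, as
  the limit of \<open>\<tau>((1 - g) c)\<close>: a ``left'' approximation \<open>(1 - g) c\<close> and a ``right'' approximation
  \<open>d (1 - h)\<close> have almost the same trace because both are close to \<open>(1 - g) a (1 - h)\<close>. The extension
  \<open>\<omega>\<close> is a trace since \<open>b = (1 - g) c \<in> B\<close> yields
  \<open>\<omega>(a a\<^sup>*) \<approx> \<tau>(b b\<^sup>*) = \<tau>(b\<^sup>* b) = \<omega>(c\<^sup>* (1 - g)\<^sup>2 c) \<le> \<omega>(c\<^sup>* c) \<approx> \<omega>(a\<^sup>* a)\<close>.

  To make \<open>\<tau>(g)\<close> small through \<open>g \<precsim> y\<close> one needs \<open>y \<noteq> 0\<close> in \<open>B\<close> supported under an element \<open>e\<close> with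
  \<open>\<tau>(e\<^sup>2)\<close> small. Splitting supports into two orthogonal halves produces it, unless at some stage no
  splitting exists; then \<open>B\<close> has a projection \<open>p \<noteq> 0\<close> with \<open>p B p = \<complex> p\<close>. Largeness would give
  \<open>p A p = \<complex> p\<close>, and the simple algebra \<open>A\<close> would be finite dimensional.\<close>

section \<open>Square roots\<close>

instance unital_cstar_algebra \<subseteq> banach ..

section \<open>Elementary facts on the adjoint, the norm and unital subalgebras\<close>

lemma scaleC_scaleR: "c *\<^sub>C r *\<^sub>R x = r *\<^sub>R c *\<^sub>C x"
  for x :: "'a::unital_cstar_algebra"
  by (simp add: scaleR_scaleC scaleC_scaleC mult.commute)

lemma adj_0 [simp]: "adj 0 = (0::'a::unital_cstar_algebra)"
  using adj_add[of 0 0] by simp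

lemma adj_1 [simp]: "adj 1 = (1::'a::unital_cstar_algebra)"
  by (metis adj_adj adj_mult mult.left_neutral)

lemma adj_scaleR [simp]: "adj (r *\<^sub>R x) = r *\<^sub>R adj x"
  for x :: "'a::unital_cstar_algebra"
  by (simp add: scaleR_scaleC adj_scaleC)

lemma adj_minus [simp]: "adj (- x) = - adj x"
  for x :: "'a::unital_cstar_algebra"
  using adj_scaleR[of "-1" x] by simp

lemma adj_diff [simp]: "adj (x - y) = adj x - adj y"
  for x :: "'a::unital_cstar_algebra"
  using adj_add[of x "- y"] by simp

declare adj_add [simp] adj_adj [simp] adj_scaleC [simp]

lemma norm_adj [simp]: "norm (adj x) = norm x"
  for x :: "'a::unital_cstar_algebra"
proof -
  have *: "norm x \<le> norm (adj x)" for x :: 'a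
    using norm_mult_ineq[of "adj x" x] cstar_identity[of x]
    by (cases "x = 0") (auto simp: power2_eq_square)
  show ?thesis
    using *[of x] *[of "adj x"] by simp
qed

lemma norm_mult_adj: "norm (x * adj x) = (norm x)\<^sup>2"
  for x :: "'a::unital_cstar_algebra"
  using cstar_identity[of "adj x"] by simp

lemma norm_selfadj_square: "adj x = x \<Longrightarrow> norm (x * x) = (norm x)\<^sup>2"
  for x :: "'a::unital_cstar_algebra"
  using cstar_identity[of x] by simp

lemma bounded_linear_adj: "bounded_linear (adj :: 'a::unital_cstar_algebra \<Rightarrow> 'a)"
  by (rule bounded_linear_intro[where K = 1]) auto

lemma bounded_linear_scaleC: "bounded_linear (\<lambda>x. c *\<^sub>C x :: 'a::unital_cstar_algebra)"
  by (rule bounded_linear_intro[where K = "cmod c"])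
     (auto simp: scaleC_add_right scaleC_scaleR norm_scaleC mult.commute)

lemma tendsto_adj [tendsto_intros]:
  "(f \<longlongrightarrow> a) F \<Longrightarrow> ((\<lambda>n. adj (f n :: 'a::unital_cstar_algebra)) \<longlongrightarrow> adj a) F"
  by (rule bounded_linear.tendsto[OF bounded_linear_adj])

lemma tendsto_scaleC [tendsto_intros]:
  "(f \<longlongrightarrow> a) F \<Longrightarrow> ((\<lambda>n. c *\<^sub>C (f n :: 'a::unital_cstar_algebra)) \<longlongrightarrow> c *\<^sub>C a) F"
  by (rule bounded_linear.tendsto[OF bounded_linear_scaleC])

lemma adj_power: "adj (x ^ n) = adj x ^ n"
  for x :: "'a::unital_cstar_algebra"
  by (induction n) (auto simp: adj_mult power_commutes)

lemma unital_subalgebra_UNIV: "unital_subalgebra UNIV"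
  by (simp add: unital_subalgebra_def)

lemma
  assumes "unital_subalgebra D"
  shows subalg_closed: "closed D"
    and subalg_one: "1 \<in> D"
    and subalg_zero: "0 \<in> D"
    and subalg_add: "\<And>x y. x \<in> D \<Longrightarrow> y \<in> D \<Longrightarrow> x + y \<in> D"
    and subalg_diff: "\<And>x y. x \<in> D \<Longrightarrow> y \<in> D \<Longrightarrow> x - y \<in> D"
    and subalg_mult: "\<And>x y. x \<in> D \<Longrightarrow> y \<in> D \<Longrightarrow> x * y \<in> D"
    and subalg_adj: "\<And>x. x \<in> D \<Longrightarrow> adj x \<in> D"
    and subalg_scaleC: "\<And>c x. x \<in> D \<Longrightarrow> c *\<^sub>C x \<in> D"
    and subalg_scaleR: "\<And>r x. x \<in> D \<Longrightarrow> r *\<^sub>R x \<in> D"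
    and subalg_power: "\<And>n x. x \<in> D \<Longrightarrow> x ^ n \<in> D"
proof -
  note D = assms[unfolded unital_subalgebra_def]
  have S: "cstar_space.subspace D" using D by blast
  show "closed D" "1 \<in> D" "\<And>x y. x \<in> D \<Longrightarrow> y \<in> D \<Longrightarrow> x * y \<in> D" "\<And>x. x \<in> D \<Longrightarrow> adj x \<in> D"
    using D by blast+
  show "0 \<in> D" "\<And>x y. x \<in> D \<Longrightarrow> y \<in> D \<Longrightarrow> x + y \<in> D"
    "\<And>x y. x \<in> D \<Longrightarrow> y \<in> D \<Longrightarrow> x - y \<in> D" "\<And>c x. x \<in> D \<Longrightarrow> c *\<^sub>C x \<in> D"
    using S cstar_space.subspace_0 cstar_space.subspace_add cstar_space.subspace_diff
      cstar_space.subspace_scale by blast+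
  then show "\<And>r x. x \<in> D \<Longrightarrow> r *\<^sub>R x \<in> D"
    by (simp add: scaleR_scaleC)
  show "x ^ n \<in> D" if "x \<in> D" for n x
    using D that by (induction n) auto
qed

lemmas subalg_intros =
  subalg_one subalg_zero subalg_add subalg_diff subalg_mult subalg_adj subalg_scaleC
  subalg_scaleR subalg_power

text \<open>Since \<open>x\<close> and \<open>y\<close> commute,
  \<open>u = x + \<i> *\<^sub>C y\<close> satisfies \<open>adj u * u = x * x + y * y\<close>, and
  its real part \<open>x\<close> has norm at most \<open>norm u\<close>. This inequality stands in
  for monotonicity of the norm on positive elements.\<close>

lemma norm_le_norm_sum_squares:
  fixes x y :: "'a::unital_cstar_algebra"
  assumes "adj x = x" "adj y = y" "x * y = y * x"
  shows "(norm x)\<^sup>2 \<le> norm (x * x + y * y)"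
proof -
  define u where "u = x + \<i> *\<^sub>C y"
  have u': "adj u = x - \<i> *\<^sub>C y"
    using assms cstar_space.scale_minus_left[of \<i> y] by (simp add: u_def)
  have "(x - \<i> *\<^sub>C y) * (x + \<i> *\<^sub>C y) = x * x + y * y"
    using assms(3)
    by (simp add: algebra_simps mult_scaleC_left mult_scaleC_right scaleC_scaleC scaleC_one)
  then have "adj u * u = x * x + y * y"
    by (simp add: u') (simp add: u_def)
  then have "(norm u)\<^sup>2 = norm (x * x + y * y)"
    by (metis cstar_identity)
  moreover have "2 *\<^sub>R x = u + adj u"
    unfolding u' by (simp add: u_def scaleR_2)
  then have "2 * norm x \<le> 2 * norm u"
    by (metis abs_numeral mult_2 norm_adj norm_scaleR norm_triangle_ineq)
  then have "(norm x)\<^sup>2 \<le> (norm u)\<^sup>2"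
    by (simp add: power_mono)
  ultimately show ?thesis by simp
qed

section \<open>The power series of \<open>sqrt (1 - x)\<close>\<close>

definition csq_coeff :: "nat \<Rightarrow> real" where
  "csq_coeff n = (-1) ^ n * ((1/2) gchoose n)"

lemma csq_coeff_0 [simp]: "csq_coeff 0 = 1"
  by (simp add: csq_coeff_def)

lemma csq_coeff_Suc: "csq_coeff (Suc n) = (real n - 1/2) / (real n + 1) * csq_coeff n"
proof -
  have "(real n + 1) * ((1/2) gchoose Suc n) = - (real n - 1/2) * ((1/2) gchoose n)"
    using gbinomial_mult_1[of "1/2 :: real" n] by (simp add: algebra_simps)
  then have eq: "((1/2) gchoose Suc n) = - (real n - 1/2) / (real n + 1) * ((1/2) gchoose n)"
    by (simp add: field_simps)
  show ?thesis
    unfolding csq_coeff_def eq by (simp add: field_simps)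
qed

lemma csq_coeff_Suc_nonpos: "csq_coeff (Suc n) \<le> 0"
proof (induction n)
  case 0
  then show ?case by (simp add: csq_coeff_Suc)
next
  case (Suc n)
  then show ?case
    unfolding csq_coeff_Suc[of "Suc n"] by (intro mult_nonneg_nonpos) auto
qed

text \<open>The alternating sums of \<open>(1/2) gchoose n\<close> telescope to
  \<open>(-1) ^ N * ((-1/2) gchoose N)\<close>, a Pochhammer symbol of 1/2 over a factorial.\<close>

lemma sum_csq_coeff_nonneg: "0 \<le> (\<Sum>n\<le>N. csq_coeff n)"
proof -
  have "(\<Sum>n\<le>N. csq_coeff n) = (-1) ^ N * ((1/2 - 1) gchoose N)"
    using gbinomial_sum_lower_neg[of "1/2 :: real" N] by (simp add: csq_coeff_def mult.commute)
  also have "\<dots> = pochhammer (1/2) N / fact N"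
    by (simp add: gbinomial_pochhammer)
  also have "\<dots> \<ge> 0"
    by (simp add: pochhammer_nonneg)
  finally show ?thesis .
qed

text \<open>All coefficients after the constant 1 are nonpositive, so this is 1 minus a nonnegative
  partial sum. The exact bound 1 is what yields \<open>norm (1 - csq x) \<le> 1\<close>.\<close>

lemma sum_abs_csq_coeff_Suc: "(\<Sum>n<N. \<bar>csq_coeff (Suc n)\<bar>) \<le> 1"
proof -
  have "(\<Sum>n\<le>N. csq_coeff n) = 1 + (\<Sum>n<N. csq_coeff (Suc n))"
    by (simp add: sum.atMost_shift)
  moreover have "(\<Sum>n<N. \<bar>csq_coeff (Suc n)\<bar>) = - (\<Sum>n<N. csq_coeff (Suc n))"
    by (simp add: abs_of_nonpos csq_coeff_Suc_nonpos sum_negf)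
  ultimately show ?thesis
    using sum_csq_coeff_nonneg[of N] by linarith
qed

lemma summable_abs_csq_coeff_Suc: "summable (\<lambda>n. \<bar>csq_coeff (Suc n)\<bar>)"
  by (rule summableI_nonneg_bounded[where x = 1]) (auto simp: sum_abs_csq_coeff_Suc)

text \<open>By Vandermonde's identity the exponents 1/2 add up to 1, which leaves the coefficients
  of \<open>1 - x\<close>.\<close>

lemma csq_coeff_convolution:
  "(\<Sum>i\<le>n. csq_coeff i * csq_coeff (n - i)) = (if n = 0 then 1 else if n = 1 then - 1 else 0)"
proof -
  have "(\<Sum>i\<le>n. csq_coeff i * csq_coeff (n - i))
      = (-1) ^ n * (\<Sum>i\<le>n. ((1/2) gchoose i) * ((1/2) gchoose (n - i)))"
    unfolding sum_distrib_left
    by (intro sum.cong) (auto simp: csq_coeff_def simp flip: power_add)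
  also have "\<dots> = (-1) ^ n * (1 gchoose n :: real)"
    using gbinomial_Vandermonde[of "1/2 :: real" "1/2" n] by (simp add: atLeast0AtMost)
  also have "(1 gchoose n :: real) = of_nat (1 choose n)"
    by (metis binomial_gbinomial of_nat_1)
  finally show ?thesis
    by (auto simp: binomial_eq_0)
qed

text \<open>The binomial series of \<open>sqrt (1 - x)\<close>; it converges absolutely even for \<open>norm x = 1\<close>.\<close>

definition csq :: "'a::{real_normed_algebra_1,banach} \<Rightarrow> 'a" where
  "csq x = (\<Sum>n. csq_coeff n *\<^sub>R x ^ n)"

lemma csq_norm_bound:
  fixes x :: "'a::{real_normed_algebra_1,banach}"
  assumes "norm x \<le> 1"
  shows "norm (csq_coeff n *\<^sub>R x ^ n) \<le> \<bar>csq_coeff n\<bar>"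
proof -
  have "norm (x ^ n) \<le> 1"
    using norm_power_ineq[of x n] power_le_one[of "norm x" n] assms by simp
  then show ?thesis
    by (simp add: mult_left_le)
qed

lemma summable_norm_csq:
  fixes x :: "'a::{real_normed_algebra_1,banach}"
  assumes "norm x \<le> 1"
  shows "summable (\<lambda>n. norm (csq_coeff n *\<^sub>R x ^ n))"
proof (rule summable_comparison_test')
  show "summable (\<lambda>n. \<bar>csq_coeff n\<bar>)"
    using summable_abs_csq_coeff_Suc by (subst (asm) summable_Suc_iff)
qed (use csq_norm_bound[OF assms] in auto)

lemma csq_sums:
  fixes x :: "'a::{real_normed_algebra_1,banach}"
  assumes "norm x \<le> 1"
  shows "(\<lambda>n. csq_coeff n *\<^sub>R x ^ n) sums csq x"
  unfolding csq_def by (intro summable_sums summable_norm_cancel[OF summable_norm_csq[OF assms]])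

lemma csq_square:
  fixes x :: "'a::{real_normed_algebra_1,banach}"
  assumes "norm x \<le> 1"
  shows "csq x * csq x = 1 - x"
proof -
  let ?f = "\<lambda>n. csq_coeff n *\<^sub>R x ^ n"
  have "(\<lambda>k. \<Sum>i\<le>k. ?f i * ?f (k - i)) sums (csq x * csq x)"
    unfolding csq_def by (rule Cauchy_product_sums; rule summable_norm_csq[OF assms])
  moreover have "(\<Sum>i\<le>k. ?f i * ?f (k - i)) =
      (if k = 0 then 1 else if k = 1 then - 1 else 0) *\<^sub>R x ^ k" for k
    unfolding csq_coeff_convolution[symmetric] scaleR_sum_left
    by (intro sum.cong) (auto simp flip: power_add)
  ultimately have "(\<lambda>k. (if k = 0 then 1 else if k = 1 then - 1 else 0) *\<^sub>R x ^ k) sums (csq x * csq x)"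
    by simp
  moreover have "(\<lambda>k. (if k = 0 then 1 else if k = 1 then - 1 else 0) *\<^sub>R x ^ k) sums
      (\<Sum>k\<in>{0, 1}. (if k = 0 then 1 else if k = 1 then - 1 else 0) *\<^sub>R x ^ k)"
    by (rule sums_finite) auto
  ultimately show ?thesis
    using sums_unique2 by fastforce
qed

lemma csq_commute:
  fixes x :: "'a::{real_normed_algebra_1,banach}"
  assumes "norm x \<le> 1" "x * y = y * x"
  shows "csq x * y = y * csq x"
proof -
  have "(\<lambda>n. csq_coeff n *\<^sub>R x ^ n * y) sums (csq x * y)"
    by (rule sums_mult2[OF csq_sums[OF assms(1)]])
  moreover have "(\<lambda>n. y * csq_coeff n *\<^sub>R x ^ n) sums (y * csq x)"
    by (rule sums_mult[OF csq_sums[OF assms(1)]])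
  moreover have "csq_coeff n *\<^sub>R x ^ n * y = y * csq_coeff n *\<^sub>R x ^ n" for n
    using power_commuting_commutes[OF assms(2), of n] by simp
  ultimately have "(\<lambda>n. y * csq_coeff n *\<^sub>R x ^ n) sums (csq x * y)"
    "(\<lambda>n. y * csq_coeff n *\<^sub>R x ^ n) sums (y * csq x)"
    by (simp_all only:)
  then show ?thesis
    by (rule sums_unique2)
qed

text \<open>A power series acts on an eigenvector through its value at the eigenvalue. Later the
  eigenvalues 1 and 0 occur, where \<open>csq\<close> is 0 and 1.\<close>

lemma csq_eigenvalue:
  fixes x :: "'a::{real_normed_algebra_1,banach}"
  assumes "norm x \<le> 1" "x * u = c *\<^sub>R u" "\<bar>c\<bar> \<le> 1"
  shows "csq x * u = csq c *\<^sub>R u"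
proof -
  have "x ^ n * u = c ^ n *\<^sub>R u" for n
    by (induction n) (auto simp: mult.assoc assms(2) power_Suc2 mult.commute simp del: power_Suc)
  then have "csq_coeff n *\<^sub>R x ^ n * u = (csq_coeff n *\<^sub>R c ^ n) *\<^sub>R u" for n
    by simp
  moreover have "(\<lambda>n. csq_coeff n *\<^sub>R x ^ n * u) sums (csq x * u)"
    by (rule sums_mult2[OF csq_sums[OF assms(1)]])
  moreover have "(\<lambda>n. (csq_coeff n *\<^sub>R c ^ n) *\<^sub>R u) sums (csq c *\<^sub>R u)"
    using assms(3) by (intro sums_scaleR_left csq_sums) auto
  ultimately show ?thesis
    using sums_unique2 by fastforce
qed

lemma csq_1_real [simp]: "csq (1::real) = 0"
  using csq_square[of "1::real"] by simp

lemma csq_0 [simp]: "csq 0 = (1 :: 'a::{real_normed_algebra_1,banach})"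
proof -
  have "(\<lambda>n. csq_coeff n *\<^sub>R (0::'a) ^ n) sums (\<Sum>n\<in>{0}. csq_coeff n *\<^sub>R (0::'a) ^ n)"
    by (rule sums_finite) (auto simp: power_0_left)
  then show ?thesis
    using csq_sums[of "0::'a"] sums_unique2 by fastforce
qed

lemma norm_one_minus_csq:
  fixes x :: "'a::{real_normed_algebra_1,banach}"
  assumes "norm x \<le> 1"
  shows "norm (1 - csq x) \<le> 1"
proof -
  have s: "(\<lambda>n. csq_coeff (Suc n) *\<^sub>R x ^ Suc n) sums (csq x - 1)"
    using csq_sums[OF assms] by (subst sums_Suc_iff) simp
  have "norm (csq x - 1) \<le> (\<Sum>n. \<bar>csq_coeff (Suc n)\<bar>)"
    unfolding sums_unique[OF s]
    by (rule norm_suminf_le[OF csq_norm_bound[OF assms] summable_abs_csq_coeff_Suc])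
  also have "\<dots> \<le> 1"
    by (rule suminf_le_const[OF summable_abs_csq_coeff_Suc]) (rule sum_abs_csq_coeff_Suc)
  finally show ?thesis
    by (simp add: norm_minus_commute)
qed

lemma adj_csq:
  fixes x :: "'a::unital_cstar_algebra"
  assumes "norm x \<le> 1" "adj x = x"
  shows "adj (csq x) = csq x"
proof -
  have "(\<lambda>n. adj (csq_coeff n *\<^sub>R x ^ n)) sums adj (csq x)"
    by (rule bounded_linear.sums[OF bounded_linear_adj csq_sums[OF assms(1)]])
  then have "(\<lambda>n. csq_coeff n *\<^sub>R x ^ n) sums adj (csq x)"
    by (simp add: adj_power assms(2))
  then show ?thesis
    by (rule sums_unique2) (rule csq_sums[OF assms(1)])
qed

lemma csq_in_subalgebra:
  fixes x :: "'a::unital_cstar_algebra"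
  assumes D: "unital_subalgebra D" and x: "x \<in> D" "norm x \<le> 1"
  shows "csq x \<in> D"
proof -
  have "(\<lambda>N. \<Sum>n<N. csq_coeff n *\<^sub>R x ^ n) \<longlonglongrightarrow> csq x"
    using csq_sums[OF x(2)] by (simp add: sums_def)
  moreover have "(\<Sum>n<N. csq_coeff n *\<^sub>R x ^ n) \<in> D" for N
    by (induction N) (use D x in \<open>auto intro!: subalg_intros\<close>)
  ultimately show ?thesis
    using closed_sequentially[OF subalg_closed[OF D], of "\<lambda>N. \<Sum>n<N. csq_coeff n *\<^sub>R x ^ n"]
    by blast
qed

text \<open>The last three clauses replace the statement that \<open>s\<close> is a limit of polynomials in \<open>S\<close> without
  constant term.\<close>

definition is_root :: "'a::unital_cstar_algebra \<Rightarrow> 'a \<Rightarrow> bool" where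
  "is_root S s \<longleftrightarrow> adj s = s \<and> s * s = S \<and> (\<forall>y. S * y = y * S \<longrightarrow> s * y = y * s) \<and>
     (\<forall>D. unital_subalgebra D \<longrightarrow> S \<in> D \<longrightarrow> s \<in> D) \<and> (\<forall>u. S * u = 0 \<longrightarrow> s * u = 0)"

lemma
  assumes "is_root S s"
  shows root_adj: "adj s = s"
    and root_square: "s * s = S"
    and root_commute: "\<And>y. S * y = y * S \<Longrightarrow> s * y = y * s"
    and root_in_subalgebra: "\<And>D. unital_subalgebra D \<Longrightarrow> S \<in> D \<Longrightarrow> s \<in> D"
    and root_annihilates: "\<And>u. S * u = 0 \<Longrightarrow> s * u = 0"
proof -
  note r = assms[unfolded is_root_def]
  show "adj s = s" "s * s = S"
    by (rule conjunct1[OF r], rule conjunct1[OF conjunct2[OF r]])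
  show "\<And>y. S * y = y * S \<Longrightarrow> s * y = y * s"
    by (rule mp[OF spec[OF conjunct1[OF conjunct2[OF conjunct2[OF r]]]]])
  show "\<And>D. unital_subalgebra D \<Longrightarrow> S \<in> D \<Longrightarrow> s \<in> D"
    by (rule mp[OF mp[OF spec[OF conjunct1[OF conjunct2[OF conjunct2[OF conjunct2[OF r]]]]]]])
  show "\<And>u. S * u = 0 \<Longrightarrow> s * u = 0"
    by (rule mp[OF spec[OF conjunct2[OF conjunct2[OF conjunct2[OF conjunct2[OF r]]]]]])
qed

text \<open>The norm hypothesis is positivity without mention of spectra: it says that the spectrum
  of \<open>S\<close> lies in \<open>[0, 2c]\<close>. It gives \<open>S = c (1 - x)\<close> with
  \<open>norm x \<le> 1\<close>, where the series applies. The bound on \<open>s\<close> has the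
  same shape as the hypothesis, so a root of the root can be taken in turn.\<close>

lemma root_exists:
  fixes S :: "'a::unital_cstar_algebra"
  assumes adj: "adj S = S" and norm: "norm (c *\<^sub>R 1 - S) \<le> c"
  shows "\<exists>s. is_root S s \<and> norm (sqrt c *\<^sub>R 1 - s) \<le> sqrt c"
proof (cases "c = 0")
  case True
  then have "S = 0" using norm by simp
  then show ?thesis
    using True by (auto simp: is_root_def intro!: exI[of _ 0] subalg_zero)
next
  case False
  then have c: "c > 0"
    using norm norm_ge_zero order_trans by (metis order_le_less)
  define x where "x = 1 - (1 / c) *\<^sub>R S"
  have "x = (1 / c) *\<^sub>R (c *\<^sub>R 1 - S)"
    using c by (simp add: x_def algebra_simps)
  then have x: "norm x \<le> 1"
    using c norm by (simp add: divide_le_eq)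
  define s where "s = sqrt c *\<^sub>R csq x"
  have "adj s = s"
    using adj x by (simp add: s_def adj_csq x_def)
  moreover have "s * s = S"
    using c by (simp add: s_def csq_square[OF x]) (simp add: x_def)
  moreover have "s * y = y * s" if "S * y = y * S" for y
    using csq_commute[OF x, of y] that by (simp add: s_def x_def algebra_simps)
  moreover have "s \<in> D" if "unital_subalgebra D" "S \<in> D" for D
    unfolding s_def using that x
    by (intro subalg_scaleR csq_in_subalgebra) (auto simp: x_def intro!: subalg_intros)
  moreover have "s * u = 0" if "S * u = 0" for u
  proof -
    have "x * u = 1 *\<^sub>R u"
      using that by (simp add: x_def algebra_simps)
    then have "csq x * u = 0"
      using csq_eigenvalue[OF x, of u 1] by simp
    then show ?thesis
      by (simp add: s_def)
  qed
  moreover have "sqrt c *\<^sub>R 1 - s = sqrt c *\<^sub>R (1 - csq x)"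
    by (simp add: s_def algebra_simps)
  then have "norm (sqrt c *\<^sub>R 1 - s) \<le> sqrt c"
    using norm_one_minus_csq[OF x] c by (simp add: mult_left_le)
  ultimately show ?thesis
    unfolding is_root_def by blast
qed

text \<open>This puts squares of self-adjoint elements under \<open>root_exists\<close>. The series
  provides a self-adjoint \<open>k\<close> that commutes with \<open>a\<close> and satisfies
  \<open>k * k + a * a = c *\<^sub>R 1\<close>, so \<open>norm_le_norm_sum_squares\<close> bounds
  \<open>k\<close>.\<close>

lemma norm_const_minus_square:
  fixes a :: "'a::unital_cstar_algebra"
  assumes a: "adj a = a" and c: "(norm a)\<^sup>2 \<le> c"
  shows "norm (c *\<^sub>R 1 - a * a) \<le> c"
proof (cases "c = 0")
  case True
  then show ?thesis using c by simp
next
  case False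
  then have c0: "c > 0" using c by (smt (verit) zero_le_power2)
  define x where "x = (1 / c) *\<^sub>R (a * a)"
  have x: "norm x \<le> 1"
    using c c0 by (simp add: x_def norm_selfadj_square[OF a])
  have x': "adj x = x" by (simp add: x_def adj_mult a)
  define k where "k = sqrt c *\<^sub>R csq x"
  have kk: "k * k = c *\<^sub>R 1 - a * a"
    using c0 by (simp add: k_def csq_square[OF x]) (simp add: x_def algebra_simps)
  have k': "adj k = k" by (simp add: k_def adj_csq x x')
  have "csq x * a = a * csq x"
    by (rule csq_commute[OF x]) (simp add: x_def mult.assoc)
  then have "k * a = a * k" by (simp add: k_def)
  then have "(norm k)\<^sup>2 \<le> norm (k * k + a * a)"
    by (rule norm_le_norm_sum_squares[OF k' a])
  then show ?thesis
    using c0 by (simp add: kk flip: norm_selfadj_square[OF k'])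
qed

text \<open>Here \<open>k = s\<^sup>2\<close> plays the role of \<open>|h|\<close>.\<close>

lemma absolute_value:
  fixes h :: "'a::unital_cstar_algebra"
  assumes h: "adj h = h"
  shows "\<exists>k s. is_root (h * h) k \<and> is_root k s"
proof -
  have 1: "adj (h * h) = h * h" by (simp add: adj_mult h)
  have 2: "norm ((norm h)\<^sup>2 *\<^sub>R 1 - h * h) \<le> (norm h)\<^sup>2"
    by (rule norm_const_minus_square[OF h]) simp
  obtain k where k: "is_root (h * h) k" "norm (sqrt ((norm h)\<^sup>2) *\<^sub>R 1 - k) \<le> sqrt ((norm h)\<^sup>2)"
    using root_exists[OF 1 2] by blast
  then show ?thesis
    using root_exists[OF root_adj[OF k(1)] k(2)] by blast
qed

text \<open>The hypothesis of \<open>root_exists\<close> is additive, by the triangle inequality;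
  hence \<open>a\<close> and \<open>b\<close> need not commute.\<close>

lemma sum_squares_root:
  fixes a b :: "'a::unital_cstar_algebra"
  assumes a: "adj a = a" and b: "adj b = b"
  shows "\<exists>s. is_root (a * a + b * b) s"
proof -
  define A where "A = (norm a)\<^sup>2"
  define B where "B = (norm b)\<^sup>2"
  have "(A + B) *\<^sub>R 1 - (a * a + b * b) = (A *\<^sub>R 1 - a * a) + (B *\<^sub>R 1 - b * b)"
    by (simp add: algebra_simps)
  also have "norm \<dots> \<le> A + B"
    by (intro norm_triangle_mono norm_const_minus_square a b) (simp_all add: A_def B_def)
  finally have "norm ((A + B) *\<^sub>R 1 - (a * a + b * b)) \<le> A + B" .
  moreover have "adj (a * a + b * b) = a * a + b * b"
    by (simp add: adj_mult a b)
  ultimately show ?thesis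
    using root_exists by blast
qed

section \<open>Positivity and traces\<close>

lemma adj_star_square: "adj (adj x * x) = adj x * x"
  for x :: "'a::unital_cstar_algebra"
  by (simp add: adj_mult)

text \<open>If \<open>v\<close> has norm 1, then so has \<open>y\<close>, and \<open>y y\<^sup>* = m\<^sup>2\<close> is a square, so \<open>1 - y y\<^sup>*\<close> is a contraction.
  Hence \<open>y\<^sup>* (1 - y y\<^sup>*)\<^sup>2 y = - v\<^sup>2 (1 + v\<^sup>2)\<^sup>2\<close> has norm at most 1, but
  \<open>v\<^sup>2 (1 + v\<^sup>2)\<^sup>2 = (2 v\<^sup>2)\<^sup>2 + (v - v\<^sup>3)\<^sup>2\<close> has norm at least 4.\<close>

lemma star_square_ne_minus_square:
  fixes y v :: "'a::unital_cstar_algebra"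
  assumes y: "adj y * y = - (v * v)" and v: "adj v = v" and norm_v: "norm v = 1"
  shows False
proof -
  have "norm (adj y * y) = 1"
    using norm_selfadj_square[OF v] norm_v by (simp add: y)
  then have norm_y: "norm y = 1"
    using norm_ge_zero[of y] by (simp add: cstar_identity power2_eq_1_iff del: norm_ge_zero)
  \<comment> \<open>Here \<open>y\<close> is half of \<open>a - \<i> *\<^sub>C b\<close>. Because
    \<open>adj y * y = - (v * v)\<close>, half of \<open>a * a + b * b\<close> plus
    \<open>v * v\<close> equals \<open>y * adj y\<close>, which is thereby a sum of squares and has
    a root; \<open>r\<close> supplies the factor 1/2.\<close>
  define a where "a = y + adj y"
  define b where "b = \<i> *\<^sub>C (y - adj y)"
  have a: "adj a = a" by (simp add: a_def add.commute)
  have b: "adj b = b"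
    by (simp add: b_def) (metis cstar_space.scale_minus_left cstar_space.scale_minus_right minus_diff_eq)
  have "b * b = - ((y - adj y) * (y - adj y))"
    by (simp add: b_def mult_scaleC_left mult_scaleC_right scaleC_scaleC)
  then have ab: "a * a + b * b = 2 *\<^sub>R (y * adj y + adj y * y)"
    by (simp add: a_def algebra_simps scaleR_2)
  obtain c where c: "is_root (a * a + b * b) c"
    using sum_squares_root[OF a b] by blast
  define r :: real where "r = sqrt (1/2)"
  have "r * r = 1/2"
    unfolding r_def by (rule trans[OF real_sqrt_mult_self]) simp
  then have "r * (r * 2) = 1"
    by (simp flip: mult.assoc)
  then have cv: "(r *\<^sub>R c) * (r *\<^sub>R c) + v * v = y * adj y"
    by (simp add: root_square[OF c] ab y)
  obtain m where "is_root (y * adj y) m"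
    using sum_squares_root[of "r *\<^sub>R c" v] v root_adj[OF c] unfolding cv by auto
  then have m: "adj m = m" "m * m = y * adj y"
    using root_adj root_square by blast+
  have "(norm m)\<^sup>2 \<le> 1"
    using norm_selfadj_square[OF m(1)] norm_mult_adj[of y] norm_y by (simp add: m(2))
  then have w: "norm (1 - y * adj y) \<le> 1"
    using norm_const_minus_square[OF m(1), of 1] by (simp add: m(2))
  have "(1 + v * v) * ((1 + v * v) * (v * v)) = - (adj y * ((1 - y * adj y) * ((1 - y * adj y) * y)))"
  proof -
    have 1: "adj y * (1 - y * adj y) = (1 + v * v) * adj y"
      using y by (simp add: algebra_simps flip: mult.assoc)
    have "adj y * ((1 - y * adj y) * u) = (1 + v * v) * (adj y * u)" for u
      using arg_cong[OF 1, of "\<lambda>x. x * u"] by (simp only: mult.assoc)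
    then show ?thesis
      by (simp add: y)
  qed
  also have "norm \<dots> \<le> norm (adj y) * (norm (1 - y * adj y) * (norm (1 - y * adj y) * norm y))"
    unfolding norm_minus_cancel
    by (meson mult_left_mono norm_ge_zero norm_mult_ineq order_trans)
  also have "\<dots> \<le> 1"
    using w norm_y by (simp add: mult_le_one)
  finally have *: "norm ((1 + v * v) * ((1 + v * v) * (v * v))) \<le> 1" .
  define p where "p = v * v + v * v"
  define q where "q = v - v * v * v"
  have "p * p + q * q = (1 + v * v) * ((1 + v * v) * (v * v))"
    by (simp add: p_def q_def algebra_simps)
  moreover have "(norm p)\<^sup>2 \<le> norm (p * p + q * q)"
    by (rule norm_le_norm_sum_squares) (simp_all add: p_def q_def adj_mult v algebra_simps)
  moreover have "norm p = 2"
    using norm_selfadj_square[OF v] by (simp add: p_def norm_v flip: scaleR_2)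
  ultimately show False
    using * by simp
qed

lemma star_square_eq_minus_square:
  fixes y v :: "'a::unital_cstar_algebra"
  assumes y: "adj y * y = - (v * v)" and v: "adj v = v"
  shows "v = 0"
proof (rule ccontr)
  assume "v \<noteq> 0"
  then show False
    using star_square_ne_minus_square[of "(1 / norm v) *\<^sub>R y" "(1 / norm v) *\<^sub>R v"] v
    by (simp add: y)
qed

text \<open>Let \<open>k\<close> be the modulus of \<open>h = adj x * x\<close>, \<open>s\<close>
  its root and \<open>n\<close> the negative part of \<open>h\<close>. Then
  \<open>n * k = n * n\<close> and \<open>n * h = - (n * n)\<close>, so \<open>x * n\<close> has
  star square \<open>- (n * n * n)\<close>, which is minus the square of \<open>n * s\<close>. By
  the previous lemma \<open>n * s = 0\<close>; hence \<open>n = 0\<close> and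
  \<open>h = k\<close>.\<close>

lemma star_square_root:
  fixes x :: "'a::unital_cstar_algebra"
  shows "\<exists>s. is_root (adj x * x) s"
proof -
  define h where "h = adj x * x"
  have h: "adj h = h" by (simp add: h_def adj_star_square)
  obtain k s where k: "is_root (h * h) k" and s: "is_root k s"
    using absolute_value[OF h] by blast
  have kh: "k * h = h * k" by (rule root_commute[OF k]) (simp add: mult.assoc)
  have sh: "s * h = h * s" by (rule root_commute[OF s kh])
  have sk: "s * k = k * s" by (rule root_commute[OF s]) simp
  define n where "n = (1/2) *\<^sub>R (k - h)"
  have n: "adj n = n" by (simp add: n_def h root_adj[OF k])
  have sn: "s * n = n * s" by (simp add: n_def right_diff_distrib left_diff_distrib sh sk)
  have nk: "n * k = n * n"
    unfolding n_def using kh root_square[OF k]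
    by (simp add: algebra_simps flip: scaleR_add_left)
  have nh: "n * h = - (n * n)"
    unfolding n_def using kh root_square[OF k]
    by (simp add: algebra_simps flip: scaleR_add_left)
  define v where "v = n * s"
  have v: "adj v = v" by (simp add: v_def adj_mult n root_adj[OF s] sn)
  have "v * v = n * (s * n) * s" by (simp add: v_def mult.assoc)
  also have "\<dots> = n * n * (s * s)" unfolding sn by (simp only: mult.assoc)
  also have "\<dots> = n * n * n" by (simp add: root_square[OF s] mult.assoc nk)
  finally have vv: "v * v = n * n * n" .
  have "adj (x * n) * (x * n) = (n * h) * n" by (simp add: adj_mult n h_def mult.assoc)
  also have "\<dots> = - (v * v)" by (simp add: nh vv)
  finally have "v = 0" using star_square_eq_minus_square v by blast
  then have "n * n * n = 0" using vv by simp
  then have "(n * n) * (n * n) = 0" by (simp add: mult.assoc[symmetric])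
  then have "n * n = 0"
    using norm_selfadj_square[of "n * n"] by (simp add: adj_mult n)
  then have "n = 0"
    using norm_selfadj_square[OF n] by simp
  then have "k = h" by (simp add: n_def)
  then show ?thesis using s unfolding h_def by blast
qed

lemma unit_interval_roots:
  fixes g :: "'a::unital_cstar_algebra"
  assumes "cstar_le D 0 g" "cstar_le D g 1"
  shows "\<exists>s r. is_root g s \<and> is_root (1 - g) r"
proof -
  obtain b d where "g = adj b * b" "1 - g = adj d * d"
    using assms by (auto simp: cstar_le_def positives_def)
  then show ?thesis using star_square_root by metis
qed

text \<open>The roots of \<open>g\<close> and \<open>1 - g\<close> commute and their squares add up
  to 1, which bounds the root of \<open>1 - g\<close> by 1.\<close>

lemma
  fixes g :: "'a::unital_cstar_algebra"
  assumes "cstar_le D 0 g" "cstar_le D g 1"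
  shows unit_interval_adj: "adj g = g"
    and unit_interval_norm_compl: "norm (1 - g) \<le> 1"
proof -
  obtain s r where s: "is_root g s" and r: "is_root (1 - g) r"
    using unit_interval_roots[OF assms] by blast
  have "s * g = g * s" by (rule root_commute[OF s]) simp
  then have "r * s = s * r" by (intro root_commute[OF r]) (simp add: algebra_simps)
  then show "norm (1 - g) \<le> 1"
    using norm_le_norm_sum_squares[of r s] root_adj[OF s] root_adj[OF r] root_square[OF s]
      root_square[OF r] norm_selfadj_square[of r] by simp
  show "adj g = g"
    using root_square[OF s] root_adj[OF s] by (metis adj_mult)
qed

lemma one_minus_square_root:
  fixes a :: "'a::unital_cstar_algebra"
  assumes a: "adj a = a" and "norm a \<le> 1"
  shows "\<exists>q. is_root (1 - a * a) q"
proof -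
  have "(norm a)\<^sup>2 \<le> 1"
    using assms(2) by (simp add: power_le_one)
  then have k: "norm (1 *\<^sub>R 1 - (1 - a * a)) \<le> 1"
    using norm_selfadj_square[OF a] by simp
  show ?thesis
    using root_exists[OF _ k] by (auto simp: adj_mult a)
qed

section \<open>Traces on a subalgebra: Cauchy--Schwarz and norm estimates\<close>

locale subalgebra_trace =
  fixes D :: "'a::unital_cstar_algebra set" and \<tau> :: "'a \<Rightarrow> complex"
  assumes D: "unital_subalgebra D" and trace: "\<tau> \<in> tracial_states D"
begin

lemmas D_intros [intro, simp] = subalg_intros[OF D]

lemma
  shows tau_add: "x \<in> D \<Longrightarrow> y \<in> D \<Longrightarrow> \<tau> (x + y) = \<tau> x + \<tau> y"
    and tau_scaleC: "x \<in> D \<Longrightarrow> \<tau> (c *\<^sub>C x) = c * \<tau> x"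
    and tau_one: "\<tau> 1 = 1"
    and tau_commute: "x \<in> D \<Longrightarrow> y \<in> D \<Longrightarrow> \<tau> (x * y) = \<tau> (y * x)"
    and tau_star_square: "x \<in> D \<Longrightarrow> \<tau> (adj x * x) \<in> \<real>\<^sub>\<ge>\<^sub>0"
  using trace unfolding tracial_states_def positives_def by blast+

lemma tau_scaleR: "x \<in> D \<Longrightarrow> \<tau> (r *\<^sub>R x) = r * \<tau> x"
  by (simp add: scaleR_scaleC tau_scaleC)

lemma tau_minus: "x \<in> D \<Longrightarrow> \<tau> (- x) = - \<tau> x"
  using tau_scaleR[of x "-1"] by simp

lemma minus_in [simp, intro]: "x \<in> D \<Longrightarrow> - x \<in> D"
  using subalg_scaleR[OF D, of x "-1"] by simp

lemma tau_diff: "x \<in> D \<Longrightarrow> y \<in> D \<Longrightarrow> \<tau> (x - y) = \<tau> x - \<tau> y"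
  using tau_add[of x "- y"] by (simp add: tau_minus)

lemma
  assumes "x \<in> D"
  shows Im_tau_star_square [simp]: "Im (\<tau> (adj x * x)) = 0"
    and Re_tau_star_square [simp]: "0 \<le> Re (\<tau> (adj x * x))"
  using tau_star_square[OF assms] by (auto elim!: nonneg_Reals_cases)

text \<open>Polarization against 1 writes \<open>4 *\<^sub>R h\<close> as a difference of star
  squares.\<close>

lemma Im_tau_selfadj:
  assumes h: "h \<in> D" "adj h = h"
  shows "Im (\<tau> h) = 0"
proof -
  have "4 *\<^sub>R h = adj (h + 1) * (h + 1) - adj (h - 1) * (h - 1)"
    by (simp add: h(2) algebra_simps) (simp add: scaleR_left_distrib[of 2 2, simplified] scaleR_2)
  then have "4 * \<tau> h = \<tau> (adj (h + 1) * (h + 1)) - \<tau> (adj (h - 1) * (h - 1))"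
    using h(1) tau_scaleR[of h 4] by (simp only: tau_diff D_intros of_real_numeral)
  then have "Im (4 * \<tau> h) = Im (\<tau> (adj (h + 1) * (h + 1))) - Im (\<tau> (adj (h - 1) * (h - 1)))"
    by (simp only: minus_complex.sel)
  also have "\<dots> = 0"
    by (simp only: Im_tau_star_square D_intros h(1) diff_self)
  finally show ?thesis by simp
qed

lemma tau_adj:
  assumes x: "x \<in> D"
  shows "\<tau> (adj x) = cnj (\<tau> x)"
proof -
  have "Im (\<tau> (x + adj x)) = 0"
    using x by (intro Im_tau_selfadj) (auto simp: add.commute)
  moreover have "Im (\<tau> (\<i> *\<^sub>C (x - adj x))) = 0"
    using x by (intro Im_tau_selfadj D_intros)
       (simp_all, metis cstar_space.scale_minus_left cstar_space.scale_minus_right minus_diff_eq)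
  ultimately show ?thesis
    using x by (simp add: tau_add tau_scaleC tau_diff complex_eq_iff)
qed

lemma Cauchy_Schwarz:
  assumes x: "x \<in> D" and y: "y \<in> D"
  shows "(cmod (\<tau> (adj x * y)))\<^sup>2 \<le> Re (\<tau> (adj x * x)) * Re (\<tau> (adj y * y))"
proof -
  define \<beta> where "\<beta> = \<tau> (adj x * y)"
  define A where "A = Re (\<tau> (adj x * x))"
  define C where "C = Re (\<tau> (adj y * y))"
  have \<beta>': "\<tau> (adj y * x) = cnj \<beta>"
    using tau_adj[of "adj x * y"] x y by (simp add: adj_mult \<beta>_def)
  have ineq: "0 \<le> A - 2 * t * (cmod \<beta>)\<^sup>2 + t\<^sup>2 * (cmod \<beta>)\<^sup>2 * C" for t :: real
  proof -
    \<comment> \<open>This phase makes both cross terms equal to the real number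
      \<open>- t * (cmod \<beta>)\<^sup>2\<close>, so a real quadratic in \<open>t\<close>
      remains.\<close>
    define l where "l = - t * cnj \<beta>"
    have "adj (x + l *\<^sub>C y) * (x + l *\<^sub>C y) =
        adj x * x + (l *\<^sub>C (adj x * y) + (cnj l *\<^sub>C (adj y * x) + (cnj l * l) *\<^sub>C (adj y * y)))"
      by (simp add: algebra_simps mult_scaleC_left mult_scaleC_right scaleC_scaleC)
    then have "\<tau> (adj (x + l *\<^sub>C y) * (x + l *\<^sub>C y)) =
        \<tau> (adj x * x) + (l * \<beta> + (cnj l * cnj \<beta> + (cnj l * l) * \<tau> (adj y * y)))"
      using x y by (simp add: tau_add tau_scaleC \<beta>' flip: \<beta>_def)
    moreover have "0 \<le> Re (\<tau> (adj (x + l *\<^sub>C y) * (x + l *\<^sub>C y)))"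
      using x y by (intro Re_tau_star_square) auto
    moreover have "l * \<beta> = - of_real (t * (cmod \<beta>)\<^sup>2)"
      by (simp add: l_def mult.commute complex_norm_square[symmetric] mult.left_commute)
    moreover have "cnj l * cnj \<beta> = - of_real (t * (cmod \<beta>)\<^sup>2)"
      by (simp add: l_def mult.assoc complex_norm_square[symmetric])
    moreover have "cnj l * l = of_real (t\<^sup>2 * (cmod \<beta>)\<^sup>2)"
      by (simp add: l_def power2_eq_square[of t] mult.assoc mult.left_commute complex_norm_square[symmetric])
    ultimately show ?thesis
      by (simp add: A_def C_def Re_complex_of_real)
  qed
  have C0: "C \<ge> 0" using y by (simp add: C_def)
  show ?thesis
  proof (cases "C = 0")
    case False
    \<comment> \<open>\<open>t = 1 / C\<close> is where the quadratic is smallest.\<close>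
    then have "0 \<le> A - (cmod \<beta>)\<^sup>2 / C"
      using ineq[of "1 / C"] by (simp add: power2_eq_square)
    then show ?thesis
      using False C0 by (simp add: pos_divide_le_eq flip: A_def C_def \<beta>_def)
  next
    case True
    have "(cmod \<beta>)\<^sup>2 = 0"
    proof (rule ccontr)
      assume ne: "(cmod \<beta>)\<^sup>2 \<noteq> 0"
      \<comment> \<open>With \<open>C = 0\<close> the expression is linear in \<open>t\<close>, and
        this \<open>t\<close> gives it the value -1.\<close>
      then show False
        using ineq[of "(A + 1) / (2 * (cmod \<beta>)\<^sup>2)"] True by simp
    qed
    then show ?thesis
      using True by (simp flip: C_def \<beta>_def)
  qed
qed

text \<open>Divided by \<open>(norm x)\<^sup>2\<close>, the element \<open>adj x * x\<close> becomes
  a contraction \<open>u\<close>, and \<open>1 - u\<close> is the square of \<open>csq u\<close>,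
  which lies in \<open>D\<close>.\<close>

lemma tau_star_square_le:
  assumes x: "x \<in> D"
  shows "Re (\<tau> (adj x * x)) \<le> (norm x)\<^sup>2"
proof (cases "x = 0")
  case True
  then show ?thesis using tau_scaleR[of 0 0] by simp
next
  case False
  define r where "r = norm x"
  have r: "r > 0" using False by (simp add: r_def)
  define u where "u = (1 / r\<^sup>2) *\<^sub>R (adj x * x)"
  have u: "norm u \<le> 1" "adj u = u" "u \<in> D"
    using r x by (simp_all add: u_def cstar_identity r_def adj_star_square)
  have "1 - u = adj (csq u) * csq u"
    using csq_square[OF u(1)] by (simp add: adj_csq u)
  then have "0 \<le> Re (\<tau> (1 - u))"
    using csq_in_subalgebra[OF D u(3,1)] by simp
  also have "\<dots> = 1 - Re (\<tau> (adj x * x)) / r\<^sup>2"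
    using u x by (simp add: tau_diff tau_one) (simp add: u_def tau_scaleR del: of_real_divide of_real_power)
  finally show ?thesis
    using r by (simp add: field_simps flip: r_def)
qed

lemma tau_norm_le:
  assumes x: "x \<in> D"
  shows "cmod (\<tau> x) \<le> norm x"
proof -
  have "(cmod (\<tau> x))\<^sup>2 \<le> Re (\<tau> (adj x * x))"
    using Cauchy_Schwarz[OF D_intros(1) x] by (simp add: tau_one)
  also have "\<dots> \<le> (norm x)\<^sup>2" by (rule tau_star_square_le[OF x])
  finally show ?thesis by (rule power2_le_imp_le) simp
qed

lemma tau_tendsto:
  assumes "\<And>n. x n \<in> D" "x \<longlonglongrightarrow> a" "a \<in> D"
  shows "(\<lambda>n. \<tau> (x n)) \<longlonglongrightarrow> \<tau> a"
proof (rule LIM_zero_cancel, rule Lim_null_comparison)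
  show "\<forall>\<^sub>F n in sequentially. cmod (\<tau> (x n) - \<tau> a) \<le> norm (x n - a)"
    using tau_norm_le[of "x _ - a"] assms by (simp add: tau_diff)
  show "(\<lambda>n. norm (x n - a)) \<longlonglongrightarrow> 0"
    using assms(2) by (simp add: LIM_zero tendsto_norm_zero)
qed

text \<open>If \<open>s\<close> and \<open>r\<close> are the roots of \<open>g\<close> and
  \<open>1 - g\<close>, then \<open>g - g * g\<close> is the star square of
  \<open>r * s\<close>.\<close>

lemma tau_unit_interval_square:
  assumes g: "cstar_le D 0 g" "cstar_le D g 1" "g \<in> D"
  shows "0 \<le> Re (\<tau> (g * g))" "Re (\<tau> (g * g)) \<le> Re (\<tau> g)"
proof -
  obtain s r where s: "is_root g s" and r: "is_root (1 - g) r"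
    using unit_interval_roots[OF g(1,2)] by blast
  have in_D: "s \<in> D" "r \<in> D"
    using g root_in_subalgebra[OF s D] root_in_subalgebra[OF r D] by auto
  have "s * g = g * s" by (rule root_commute[OF s]) simp
  then have rs: "r * s = s * r" by (intro root_commute[OF r]) (simp add: algebra_simps)
  have "adj (r * s) * (r * s) = s * (r * r) * s"
    by (simp add: adj_mult root_adj[OF s] root_adj[OF r] mult.assoc)
  also have "\<dots> = s * s - s * s * (s * s)"
    unfolding root_square[OF r] root_square[OF s, symmetric] by (simp add: algebra_simps)
  also have "\<dots> = g - g * g"
    by (simp add: root_square[OF s])
  finally have "0 \<le> Re (\<tau> (g - g * g))"
    using Re_tau_star_square[of "r * s"] in_D by simp
  then show "Re (\<tau> (g * g)) \<le> Re (\<tau> g)"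
    using g by (simp add: tau_diff)
  show "0 \<le> Re (\<tau> (g * g))"
    using Re_tau_star_square[of g] g(3) unit_interval_adj[OF g(1,2)] by simp
qed

text \<open>The basic smallness estimate: Cauchy--Schwarz produces \<open>\<tau> (g * g)\<close>,
  which the previous lemma replaces by \<open>\<tau> g\<close>.\<close>

lemma
  assumes g: "cstar_le D 0 g" "cstar_le D g 1" "g \<in> D" and x: "x \<in> D"
  shows tau_mult_left_le: "cmod (\<tau> (g * x)) \<le> sqrt (Re (\<tau> g)) * norm x"
    and tau_mult_right_le: "cmod (\<tau> (x * g)) \<le> sqrt (Re (\<tau> g)) * norm x"
proof -
  have "(cmod (\<tau> (g * x)))\<^sup>2 \<le> Re (\<tau> (g * g)) * Re (\<tau> (adj x * x))"
    using Cauchy_Schwarz[OF g(3) x] unit_interval_adj[OF g(1,2)] by simp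
  also have "\<dots> \<le> Re (\<tau> g) * (norm x)\<^sup>2"
    using tau_unit_interval_square[OF g] x by (intro mult_mono tau_star_square_le) auto
  finally have "(cmod (\<tau> (g * x)))\<^sup>2 \<le> Re (\<tau> g) * (norm x)\<^sup>2" .
  then have "sqrt ((cmod (\<tau> (g * x)))\<^sup>2) \<le> sqrt (Re (\<tau> g) * (norm x)\<^sup>2)"
    by (rule real_sqrt_le_mono)
  then show "cmod (\<tau> (g * x)) \<le> sqrt (Re (\<tau> g)) * norm x"
    by (simp add: real_sqrt_mult)
  then show "cmod (\<tau> (x * g)) \<le> sqrt (Re (\<tau> g)) * norm x"
    using tau_commute[OF x g(3)] by simp
qed

end

section \<open>Orthogonal splitting and minimal projections\<close>

text \<open>For self-adjoint \<open>e\<close> this is the hereditary subalgebra annihilated by \<open>1 - e\<close>; here \<open>e\<close> need not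
  be a projection.\<close>

definition corner :: "'a::unital_cstar_algebra set \<Rightarrow> 'a \<Rightarrow> 'a set" where
  "corner D e = {u \<in> D. e * u = u \<and> u * e = u}"

text \<open>With \<open>h = 1 - 2 z\<^sup>2\<close>, let \<open>f\<close> and \<open>w\<close> be the positive and the negative part of \<open>h\<close>. Then \<open>f w = 0\<close>, so
  \<open>e' = 1 - f\<^sup>2\<close> acts as a unit on \<open>w\<close>, and \<open>w \<noteq> 0\<close> because \<open>z\<close> has norm 1.\<close>

lemma local_unit_exists:
  fixes z :: "'a::unital_cstar_algebra"
  assumes D: "unital_subalgebra D" and z: "z \<in> D" "adj z = z" "norm z = 1"
  shows "\<exists>e' \<in> D. adj e' = e' \<and> norm e' \<le> 1 \<and> corner D e' \<noteq> {0} \<and> (\<forall>u. z * u = 0 \<longrightarrow> e' * u = 0)"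
proof -
  define h where "h = 1 - 2 *\<^sub>R (z * z)"
  have h: "adj h = h" by (simp add: h_def adj_mult z)
  have hz: "h * z = z * h" by (simp add: h_def algebra_simps)
  obtain k where k: "is_root (1 - z * z) k"
    using one_minus_square_root[OF z(2)] z(3) by auto
  have kz: "k * z = z * k" by (rule root_commute[OF k]) (simp add: algebra_simps)
  \<comment> \<open>If \<open>z\<close> is read as a sine and \<open>k\<close> as the cosine, then
    \<open>h\<close> and \<open>y\<close> are the cosine and the sine of the doubled angle; so
    \<open>h * h + y * y = 1\<close>.\<close>
  define y where "y = 2 *\<^sub>R (z * k)"
  have "z * k * (z * k) = z * (k * z) * k" by (simp only: mult.assoc)
  also have "\<dots> = z * z * (k * k)" unfolding kz by (simp only: mult.assoc)
  also have "\<dots> = z * z - z * z * (z * z)" unfolding root_square[OF k] by (simp add: algebra_simps)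
  finally have "y * y = 4 *\<^sub>R (z * z - z * z * (z * z))"
    by (simp add: y_def)
  moreover have "h * h = 1 - 4 *\<^sub>R (z * z - z * z * (z * z))"
    by (simp add: h_def algebra_simps) (simp flip: scaleR_add_left)
  ultimately have hy: "h * h + y * y = 1" by simp
  have "k * h = h * k"
    by (rule root_commute[OF k]) (simp add: h_def algebra_simps)
  then have "z * k * h = h * (z * k)"
    using hz by (metis mult.assoc)
  then have "(norm h)\<^sup>2 \<le> 1"
    using norm_le_norm_sum_squares[OF h, of y] hy
    by (simp add: y_def adj_mult z root_adj[OF k] kz)
  then have nh: "norm h \<le> 1" by (simp add: power_le_one_iff)
  define x where "x = 1 - h * h"
  have x: "norm x \<le> 1" "adj x = x" "x \<in> D"
    using norm_const_minus_square[OF h, of 1] nh D z(1)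
    by (auto simp: x_def power_le_one adj_mult h, simp add: h_def, intro subalg_intros)
  \<comment> \<open>\<open>K\<close> is the modulus of \<open>h\<close>. Taking it as a series in
    \<open>x\<close> lets \<open>csq_eigenvalue\<close> compute \<open>K * u\<close> at the end,
    where \<open>x * u = 0\<close>.\<close>
  define K where "K = csq x"
  have K: "adj K = K" "K \<in> D" "K * K = h * h" "K * h = h * K"
    using x D csq_square[OF x(1)]
    by (auto simp: K_def adj_csq csq_in_subalgebra x_def algebra_simps intro!: csq_commute)
  have "(norm K)\<^sup>2 \<le> 1"
    using norm_selfadj_square[OF K(1)] norm_selfadj_square[OF h] nh by (simp add: K(3) power_le_one)
  then have nK: "norm K \<le> 1" by (simp add: power_le_one_iff)
  have hD: "h \<in> D" unfolding h_def using D z(1) by (intro subalg_intros)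
  define f where "f = (1/2) *\<^sub>R (K + h)"
  define w where "w = (1/2) *\<^sub>R (K - h)"
  define e' where "e' = 1 - f * f"
  have f: "adj f = f" "f \<in> D" "norm f \<le> 1"
    using K h hD D norm_triangle_ineq[of K h] nK nh by (auto simp: f_def intro!: subalg_intros)
  have fw: "f * w = 0" "w * f = 0"
    by (simp_all add: f_def w_def algebra_simps K)
  \<comment> \<open>If \<open>w = 0\<close>, then \<open>h = K\<close> has a root \<open>s\<close>,
    and \<open>2 *\<^sub>R (z * z) + s * s = 1\<close> would force 2 to be at most 1.\<close>
  have "w \<noteq> 0"
  proof
    assume "w = 0"
    then have "K = h" by (simp add: w_def)
    moreover obtain s where s: "is_root K s"
      using root_exists[OF K(1), of 1] norm_one_minus_csq[OF x(1)] by (auto simp: K_def)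
    ultimately have ss: "s * s = 1 - 2 *\<^sub>R (z * z)" and "s * z = z * s"
      using root_square[OF s] root_commute[OF s, of z] hz by (simp_all add: h_def)
    define z' where "z' = sqrt 2 *\<^sub>R z"
    have "z' * z' + s * s = 1" by (simp add: z'_def ss)
    moreover have "(norm z')\<^sup>2 \<le> norm (z' * z' + s * s)"
      by (rule norm_le_norm_sum_squares) (simp_all add: z'_def z root_adj[OF s] \<open>s * z = z * s\<close>)
    ultimately show False by (simp add: z'_def z power_mult_distrib)
  qed
  moreover have "w \<in> corner D e'"
  proof -
    have "f * f * w = 0" "w * (f * f) = 0"
      by (simp add: mult.assoc fw) (simp add: fw flip: mult.assoc)
    moreover have "w \<in> D"
      unfolding w_def using K(2) hD D by (intro subalg_intros)
    ultimately show ?thesis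
      by (simp add: corner_def e'_def left_diff_distrib right_diff_distrib)
  qed
  ultimately have "corner D e' \<noteq> {0}" by blast
  moreover have "e' \<in> D" unfolding e'_def using f D by (intro subalg_intros)
  moreover have "adj e' = e'" by (simp add: e'_def adj_mult f)
  moreover have "norm e' \<le> 1"
    using norm_const_minus_square[OF f(1), of 1] f(3) by (simp add: e'_def power_le_one)
  moreover have "e' * u = 0" if "z * u = 0" for u
  proof -
    have hu: "h * u = u" using that by (simp add: h_def algebra_simps)
    then have "x * u = 0 *\<^sub>R u" by (simp add: x_def algebra_simps)
    then have "K * u = u" using csq_eigenvalue[OF x(1), of u 0] by (simp add: K_def)
    then have "f * u = u" using hu by (simp add: f_def algebra_simps flip: scaleR_2)
    then show ?thesis by (simp add: e'_def algebra_simps)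
  qed
  ultimately show ?thesis by blast
qed

text \<open>Local units \<open>e1\<close>, \<open>e2\<close> for \<open>z1\<close>,
  \<open>z2\<close> are mutually orthogonal and absorbed by \<open>e\<close>. Then
  \<open>e * e - e1 * e1 - e2 * e2\<close> is the star square of \<open>q2 * q1 * e\<close>, so the
  traces of \<open>e1 * e1\<close> and \<open>e2 * e2\<close> add up to at most that of
  \<open>e * e\<close>, and one of them is at most half.\<close>

lemma (in subalgebra_trace) corner_halving:
  assumes e: "e \<in> D" "adj e = e"
    and z1: "z1 \<in> corner D e" "adj z1 = z1" "z1 \<noteq> 0"
    and z2: "z2 \<in> corner D e" "adj z2 = z2" "z2 \<noteq> 0"
    and orth: "z1 * z2 = 0"
  shows "\<exists>e' \<in> D. adj e' = e' \<and> corner D e' \<noteq> {0} \<and> 2 * Re (\<tau> (e' * e')) \<le> Re (\<tau> (e * e))"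
proof -
  have nz: "(1 / norm z) *\<^sub>R z \<in> D \<and> adj ((1 / norm z) *\<^sub>R z) = (1 / norm z) *\<^sub>R z \<and> norm ((1 / norm z) *\<^sub>R z) = 1"
    if "z \<in> corner D e" "adj z = z" "z \<noteq> 0" for z
    using that by (auto simp: corner_def)
  obtain e1 where e1: "e1 \<in> D" "adj e1 = e1" "norm e1 \<le> 1" "corner D e1 \<noteq> {0}"
    "\<And>u. z1 * u = 0 \<Longrightarrow> e1 * u = 0"
    using local_unit_exists[OF D, of "(1 / norm z1) *\<^sub>R z1"] nz[OF z1] by fastforce
  obtain e2 where e2: "e2 \<in> D" "adj e2 = e2" "norm e2 \<le> 1" "corner D e2 \<noteq> {0}"
    "\<And>u. z2 * u = 0 \<Longrightarrow> e2 * u = 0"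
    using local_unit_exists[OF D, of "(1 / norm z2) *\<^sub>R z2"] nz[OF z2] by fastforce
  have "z1 * (1 - e) = 0" "z2 * (1 - e) = 0"
    using z1(1) z2(1) by (auto simp: corner_def algebra_simps)
  then have "e1 * (1 - e) = 0" "e2 * (1 - e) = 0"
    using e1(5) e2(5) by blast+
  then have ee: "e1 * e = e1" "e2 * e = e2"
    by (simp_all add: algebra_simps)
  have ee': "e * e1 = e1" "e * e2 = e2"
    using arg_cong[OF ee(1), of adj] arg_cong[OF ee(2), of adj] by (simp_all add: adj_mult e e1 e2)
  \<comment> \<open>Orthogonality passes from \<open>z1\<close> to \<open>e1\<close>, and after
    taking adjoints from \<open>z2\<close> to \<open>e2\<close>.\<close>
  have "e1 * z2 = 0" by (rule e1(5)[OF orth])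
  then have "adj (e1 * z2) = 0" by simp
  then have "z2 * e1 = 0" by (simp add: adj_mult z2 e1)
  then have e21: "e2 * e1 = 0" by (rule e2(5))
  then have "adj (e2 * e1) = 0" by simp
  then have e12: "e1 * e2 = 0" by (simp add: adj_mult e1 e2)
  obtain q1 where q1: "is_root (1 - e1 * e1) q1"
    using one_minus_square_root[OF e1(2,3)] by blast
  obtain q2 where q2: "is_root (1 - e2 * e2) q2"
    using one_minus_square_root[OF e2(2,3)] by blast
  have q1e2: "q1 * e2 = e2 * q1"
    by (rule root_commute[OF q1]) (simp add: algebra_simps e12, simp add: mult.assoc[symmetric] e21)
  have q1D: "q1 \<in> D" and q2D: "q2 \<in> D"
    using root_in_subalgebra[OF q1 D] root_in_subalgebra[OF q2 D] e1(1) e2(1) by simp_all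
  have "q1 * (1 - e2 * e2) = (1 - e2 * e2) * q1"
    using q1e2 by (simp add: algebra_simps) (metis mult.assoc)
  then have q12: "q1 * (q2 * q2) = (q2 * q2) * q1"
    by (simp add: root_square[OF q2])
  have "adj (q2 * q1 * e) * (q2 * q1 * e) = e * (q1 * (q2 * q2)) * q1 * e"
    by (simp add: adj_mult root_adj[OF q1] root_adj[OF q2] e mult.assoc)
  also have "\<dots> = e * ((1 - e2 * e2) * (1 - e1 * e1)) * e"
    unfolding q12 root_square[OF q1, symmetric] root_square[OF q2, symmetric] by (simp only: mult.assoc)
  also have "(1 - e2 * e2) * (1 - e1 * e1) = 1 - e1 * e1 - e2 * e2 + e2 * (e2 * e1) * e1"
    by (simp add: algebra_simps)
  also have "\<dots> = 1 - e1 * e1 - e2 * e2"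
    by (simp add: e21)
  also have "e * (1 - e1 * e1 - e2 * e2) * e = e * e - (e * e1) * (e1 * e) - (e * e2) * (e2 * e)"
    by (simp add: algebra_simps)
  also have "\<dots> = e * e - e1 * e1 - e2 * e2"
    by (simp add: ee ee')
  finally have "0 \<le> Re (\<tau> (e * e - e1 * e1 - e2 * e2))"
    using Re_tau_star_square[of "q2 * q1 * e"] q1D q2D e(1) by simp
  then have "Re (\<tau> (e1 * e1)) + Re (\<tau> (e2 * e2)) \<le> Re (\<tau> (e * e))"
    using e e1 e2 by (simp add: tau_diff)
  then have "2 * Re (\<tau> (e1 * e1)) \<le> Re (\<tau> (e * e)) \<or> 2 * Re (\<tau> (e2 * e2)) \<le> Re (\<tau> (e * e))"
    by linarith
  then show ?thesis
    using e1 e2 by blast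
qed

lemma
  assumes D: "unital_subalgebra D"
  shows corner_scaleR: "u \<in> corner D e \<Longrightarrow> r *\<^sub>R u \<in> corner D e"
    and corner_add: "u \<in> corner D e \<Longrightarrow> v \<in> corner D e \<Longrightarrow> u + v \<in> corner D e"
    and corner_diff: "u \<in> corner D e \<Longrightarrow> v \<in> corner D e \<Longrightarrow> u - v \<in> corner D e"
    and corner_mult: "u \<in> corner D e \<Longrightarrow> v \<in> corner D e \<Longrightarrow> u * v \<in> corner D e"
    and corner_mult3: "u \<in> corner D e \<Longrightarrow> b \<in> D \<Longrightarrow> v \<in> corner D e \<Longrightarrow> u * b * v \<in> corner D e"
    and corner_adj: "adj e = e \<Longrightarrow> u \<in> corner D e \<Longrightarrow> adj u \<in> corner D e"
  using D by (auto simp: corner_def algebra_simps intro: subalg_intros)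
    (metis mult.assoc adj_mult subalg_mult[OF D])+

definition minimal_projection :: "'a::unital_cstar_algebra set \<Rightarrow> 'a \<Rightarrow> bool" where
  "minimal_projection D p \<longleftrightarrow>
     p \<in> D \<and> p \<noteq> 0 \<and> adj p = p \<and> p * p = p \<and> (\<forall>b\<in>D. \<exists>c. p * b * p = c *\<^sub>C p)"

text \<open>For \<open>0 < t < 1\<close> the element \<open>d = a\<^sup>2 - t a\<close>, with \<open>a = h\<^sup>2\<close> of norm 1, is positive or negative because its
  positive and negative parts are orthogonal; it cannot be negative, as the norm of \<open>a\<close> is 1. Let \<open>t\<close>
  tend to 1.\<close>

lemma corner_square_idempotent:
  assumes D: "unital_subalgebra D" and e: "e \<in> D" "adj e = e"
    and prime: "\<And>u v. u \<in> corner D e \<Longrightarrow> v \<in> corner D e \<Longrightarrow> adj u = u \<Longrightarrow> adj v = v \<Longrightarrow>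
      u * v = 0 \<Longrightarrow> u = 0 \<or> v = 0"
    and h: "h \<in> corner D e" "adj h = h" "norm h = 1"
  shows "(h * h) * (h * h) = h * h"
proof -
  define a where "a = h * h"
  have a: "a \<in> corner D e" "adj a = a" "norm a = 1"
    using corner_mult[OF D h(1) h(1)] norm_selfadj_square[OF h(2)] h by (simp_all add: a_def adj_mult)
  obtain q where q: "is_root (1 - a) q"
    using one_minus_square_root[OF h(2)] h(3) unfolding a_def by auto
  have qh: "q * h = h * q" by (rule root_commute[OF q]) (simp add: a_def algebra_simps)
  have "q * h * (q * h) = q * (h * q) * h" by (simp only: mult.assoc)
  also have "\<dots> = q * q * a" unfolding qh[symmetric] a_def by (simp only: mult.assoc)
  also have "\<dots> = a - a * a" by (simp add: root_square[OF q] algebra_simps)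
  finally have qhqh: "q * h * (q * h) = a - a * a" .
  have bound: "(norm (q * h))\<^sup>2 \<le> 1 - t" if t: "0 < t" "t < 1" for t :: real
  proof -
    define d where "d = a * a - t *\<^sub>R a"
    have d: "d \<in> corner D e" "adj d = d"
      using a D by (auto simp: d_def adj_mult intro!: corner_diff corner_mult corner_scaleR)
    obtain k s where k: "is_root (d * d) k" and s: "is_root k s"
      using absolute_value[OF d(2)] by blast
    \<comment> \<open>That \<open>k\<close> lies in the corner is read off from its annihilating
      \<open>1 - e\<close>, as \<open>d * d\<close> does.\<close>
    have "d * d * (1 - e) = 0"
      using d(1) by (simp add: corner_def algebra_simps)
    then have "k * (1 - e) = 0"
      by (rule root_annihilates[OF k])
    then have ke: "k * e = k" by (simp add: algebra_simps)
    then have "adj (k * e) = adj k" by simp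
    then have "e * k = k" by (simp add: adj_mult e root_adj[OF k])
    moreover have "k \<in> D"
      using root_in_subalgebra[OF k D] d(1) D by (simp add: corner_def subalg_mult)
    ultimately have kc: "k \<in> corner D e" using ke by (simp add: corner_def)
    have kd: "k * d = d * k" by (rule root_commute[OF k]) (simp only: mult.assoc)
    have "(k - d) * (k + d) = 0"
      using kd root_square[OF k] by (simp add: algebra_simps)
    then have "k - d = 0 \<or> k + d = 0"
      using kc d D root_adj[OF k] by (intro prime corner_diff corner_add) simp_all
    have dh: "d * h = h * d" by (simp add: d_def a_def algebra_simps)
    have "k * h = h * k" by (rule root_commute[OF k]) (metis dh mult.assoc)
    then have sh: "s * h = h * s" by (rule root_commute[OF s])
    \<comment> \<open>\<open>k = - d\<close> would give
      \<open>a * a + s * s = t *\<^sub>R a\<close>, and comparing norms would give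
      \<open>1 \<le> t\<close>.\<close>
    have "k + d \<noteq> 0"
    proof
      assume "k + d = 0"
      then have "a * a + s * s = t *\<^sub>R a"
        by (simp add: root_square[OF s] d_def algebra_simps)
      moreover have "(norm a)\<^sup>2 \<le> norm (a * a + s * s)"
        by (rule norm_le_norm_sum_squares[OF a(2) root_adj[OF s]]) (metis a_def mult.assoc sh)
      ultimately show False using a(3) t by simp
    qed
    \<comment> \<open>Now \<open>s * s = a * a - t *\<^sub>R a\<close>; adding
      \<open>a - a * a\<close>, the square of \<open>q * h\<close>, leaves
      \<open>(1 - t) *\<^sub>R a\<close>.\<close>
    then have "k = d" using \<open>k - d = 0 \<or> k + d = 0\<close> by simp
    then have "q * h * (q * h) + s * s = (1 - t) *\<^sub>R a"
      unfolding qhqh root_square[OF s] by (simp add: d_def algebra_simps)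
    moreover have "q * s = s * q"
      by (rule root_commute[OF q]) (simp add: a_def algebra_simps, metis sh mult.assoc)
    then have "(norm (q * h))\<^sup>2 \<le> norm (q * h * (q * h) + s * s)"
      using sh by (intro norm_le_norm_sum_squares)
        (simp_all add: adj_mult h root_adj[OF q] root_adj[OF s] qh, metis mult.assoc)
    ultimately show ?thesis using a(3) t by simp
  qed
  have "(norm (q * h))\<^sup>2 \<le> 0"
  proof (rule field_le_epsilon)
    fix \<epsilon> :: real assume "\<epsilon> > 0"
    \<comment> \<open>The minimum with 1/2 keeps \<open>t\<close> strictly between 0 and 1.\<close>
    then show "(norm (q * h))\<^sup>2 \<le> 0 + \<epsilon>"
      using bound[of "1 - min \<epsilon> (1/2)"] by simp
  qed
  then show ?thesis using qhqh by (simp add: a_def)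
qed

text \<open>By the previous lemma the square of any self-adjoint norm-one element of the corner is a
  projection; let \<open>p\<close> be one of these. For a nonzero self-adjoint \<open>u\<close> of
  norm \<open>r\<close> in the compression by \<open>p\<close>, the projection
  \<open>q = u * u / r\<^sup>2\<close> satisfies \<open>q * (p - q) = 0\<close>, so
  \<open>q = p\<close> by \<open>prime\<close>. Then \<open>u - r *\<^sub>R p\<close> and
  \<open>u + r *\<^sub>R p\<close> have product 0, so \<open>u\<close> is a multiple of
  \<open>p\<close>. Real and imaginary parts give the general case.\<close>

lemma minimal_projection_exists:
  assumes D: "unital_subalgebra D" and e: "e \<in> D" "adj e = e" "corner D e \<noteq> {0}"
    and prime: "\<And>u v. u \<in> corner D e \<Longrightarrow> v \<in> corner D e \<Longrightarrow> adj u = u \<Longrightarrow> adj v = v \<Longrightarrow>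
      u * v = 0 \<Longrightarrow> u = 0 \<or> v = 0"
  shows "\<exists>p. minimal_projection D p"
proof -
  have square: "(h * h) * (h * h) = (norm h)\<^sup>2 *\<^sub>R (h * h)" if h: "h \<in> corner D e" "adj h = h" for h
  proof (cases "h = 0")
    case False
    define r where "r = norm h"
    define u where "u = (1 / r) *\<^sub>R h"
    have "(u * u) * (u * u) = u * u"
      using h False D
      by (intro corner_square_idempotent[OF D e(1,2) prime]) (simp_all add: u_def r_def corner_scaleR)
    moreover have "h = r *\<^sub>R u" using False by (simp add: u_def r_def)
    then have "h * h = (r * r) *\<^sub>R (u * u)" by simp
    ultimately show ?thesis
      by (simp add: power2_eq_square flip: r_def)
  qed simp
  have "0 \<in> corner D e" using D by (simp add: corner_def subalg_zero)
  then obtain w where w: "w \<in> corner D e" "w \<noteq> 0" using e(3) by blast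
  define z where "z = adj w * w"
  have z: "z \<in> corner D e" "adj z = z" "z \<noteq> 0"
    using w e D cstar_identity[of w] by (auto simp: z_def adj_mult intro!: corner_mult corner_adj)
  define y where "y = (1 / norm z) *\<^sub>R z"
  have y: "y \<in> corner D e" "adj y = y" "norm y = 1"
    using z D by (simp_all add: y_def corner_scaleR)
  define p where "p = y * y"
  have p: "p \<in> corner D e" "adj p = p" "norm p = 1" "p * p = p"
    using y D norm_selfadj_square[OF y(2)] square[OF y(1,2)] by (simp_all add: p_def corner_mult adj_mult)
  have real: "\<exists>r. p * h * p = r *\<^sub>R p" if h: "h \<in> D" "adj h = h" for h
  proof -
    define u where "u = p * h * p"
    have u: "u \<in> corner D e" "adj u = u" "p * u = u" "u * p = u"
    proof -
      show "u \<in> corner D e"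
        unfolding u_def by (rule corner_mult3[OF D p(1) h(1) p(1)])
      show "adj u = u" "p * u = u" "u * p = u"
        using p(4) by (simp_all add: u_def adj_mult p(2) h(2) mult.assoc) (simp flip: mult.assoc)
    qed
    show ?thesis
    proof (cases "u = 0")
      case True
      then show ?thesis by (auto simp: u_def intro: exI[of _ 0])
    next
      case False
      define r where "r = norm u"
      have r: "r \<noteq> 0" using False by (simp add: r_def)
      define q where "q = (1 / r\<^sup>2) *\<^sub>R (u * u)"
      have uu: "u * u = r\<^sup>2 *\<^sub>R q" using r by (simp add: q_def)
      have q: "q \<in> corner D e" "adj q = q" "q * p = q"
        using u D by (simp_all add: q_def corner_scaleR corner_mult adj_mult mult.assoc)
      have "u * u * (u * u) = r\<^sup>2 *\<^sub>R (u * u)"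
        unfolding r_def by (rule square[OF u(1,2)])
      then have "q * q = q"
        using r by (simp add: q_def)
      have "q * (p - q) = 0" by (simp add: q \<open>q * q = q\<close> algebra_simps)
      then have "q = 0 \<or> p - q = 0"
        using q p D by (intro prime corner_diff) simp_all
      moreover have "q \<noteq> 0" using norm_selfadj_square[OF u(2)] False uu by auto
      ultimately have "u * u = r\<^sup>2 *\<^sub>R p" using uu by simp
      then have "(u - r *\<^sub>R p) * (u + r *\<^sub>R p) = 0"
        by (simp add: algebra_simps u p power2_eq_square)
      then have "u - r *\<^sub>R p = 0 \<or> u + r *\<^sub>R p = 0"
        using u p D by (intro prime corner_diff corner_add corner_scaleR) simp_all
      then have "u = r *\<^sub>R p \<or> u = (- r) *\<^sub>R p"
        by (auto simp: add_eq_0_iff2)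
      then show ?thesis unfolding u_def by blast
    qed
  qed
  have "\<exists>c. p * b * p = c *\<^sub>C p" if b: "b \<in> D" for b
  proof -
    define h1 where "h1 = (1/2) *\<^sub>R (b + adj b)"
    define h2 where "h2 = (1/2) *\<^sub>R (\<i> *\<^sub>C (adj b - b))"
    have h: "h1 \<in> D" "h2 \<in> D" "adj h1 = h1"
      using b D by (auto simp: h1_def h2_def add.commute intro!: subalg_intros)
    have "adj h2 = (1/2) *\<^sub>R ((- \<i>) *\<^sub>C - (adj b - b))"
      by (simp add: h2_def)
    also have "\<dots> = h2"
      by (simp only: cstar_space.scale_minus_left cstar_space.scale_minus_right minus_minus h2_def)
    finally have "adj h2 = h2" .
    have "\<i> *\<^sub>C h2 = (1/2) *\<^sub>R ((\<i> * \<i>) *\<^sub>C (adj b - b))"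
      by (simp only: h2_def scaleC_scaleR scaleC_scaleC)
    also have "\<dots> = (1/2) *\<^sub>R (b - adj b)"
      by (simp add: scaleC_one)
    finally have i: "\<i> *\<^sub>C h2 = (1/2) *\<^sub>R (b - adj b)" .
    have "h1 + \<i> *\<^sub>C h2 = b"
      unfolding h1_def i scaleR_add_right[symmetric] by (simp flip: scaleR_2)
    obtain r1 r2 where "p * h1 * p = r1 *\<^sub>R p" "p * h2 * p = r2 *\<^sub>R p"
      using real h \<open>adj h2 = h2\<close> by blast
    then have "p * (h1 + \<i> *\<^sub>C h2) * p = (of_real r1 + \<i> * of_real r2) *\<^sub>C p"
      by (simp add: algebra_simps mult_scaleC_left mult_scaleC_right scaleC_add_left scaleR_scaleC scaleC_scaleC)
    then show ?thesis unfolding \<open>h1 + \<i> *\<^sub>C h2 = b\<close> by blast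
  qed
  then show ?thesis
    using p unfolding minimal_projection_def corner_def by (intro exI[of _ p]) auto
qed

section \<open>Large subalgebras have no minimal projections\<close>

text \<open>Halving is iterated from \<open>e = 1\<close>. At each stage the corner contains two
  orthogonal nonzero self-adjoint elements, since otherwise \<open>minimal_projection_exists\<close>
  would apply.\<close>

lemma (in subalgebra_trace) small_local_unit:
  assumes no_min: "\<nexists>p. minimal_projection D p" and \<epsilon>: "\<epsilon> > 0"
  shows "\<exists>e\<in>D. adj e = e \<and> corner D e \<noteq> {0} \<and> Re (\<tau> (e * e)) < \<epsilon>"
proof -
  have "\<exists>e\<in>D. adj e = e \<and> corner D e \<noteq> {0} \<and> 2 ^ n * Re (\<tau> (e * e)) \<le> 1" for n :: nat
  proof (induction n)
    case 0
    have "1 \<in> corner D 1" by (simp add: corner_def)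
    then have "corner D 1 \<noteq> {0}" by (metis singletonD zero_neq_one)
    moreover have "2 ^ 0 * Re (\<tau> (1 * 1)) \<le> 1" by (simp add: tau_one)
    ultimately show ?case using D_intros(1) adj_1 by blast
  next
    case (Suc n)
    then obtain e where e: "e \<in> D" "adj e = e" "corner D e \<noteq> {0}" "2 ^ n * Re (\<tau> (e * e)) \<le> 1"
      by blast
    obtain u v where uv: "u \<in> corner D e" "v \<in> corner D e" "adj u = u" "adj v = v" "u * v = 0"
      "u \<noteq> 0" "v \<noteq> 0"
      using minimal_projection_exists[OF D e(1-3)] no_min by blast
    obtain e' where e': "e' \<in> D" "adj e' = e'" "corner D e' \<noteq> {0}"
      "2 * Re (\<tau> (e' * e')) \<le> Re (\<tau> (e * e))"
      using corner_halving[OF e(1,2) uv(1,3,6) uv(2,4,7) uv(5)] by blast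
    have "2 ^ Suc n * Re (\<tau> (e' * e')) = 2 ^ n * (2 * Re (\<tau> (e' * e')))" by simp
    also have "\<dots> \<le> 2 ^ n * Re (\<tau> (e * e))"
      by (rule mult_left_mono[OF e'(4)]) simp
    also note e(4)
    finally show ?case using e'(1-3) by blast
  qed note * = this
  obtain n where n: "(1/2) ^ n < \<epsilon>"
    using real_arch_pow_inv[OF \<epsilon>, of "1/2"] by auto
  obtain e where e: "e \<in> D" "adj e = e" "corner D e \<noteq> {0}" "2 ^ n * Re (\<tau> (e * e)) \<le> 1"
    using *[of n] by blast
  then have "Re (\<tau> (e * e)) \<le> (1/2) ^ n"
    by (simp add: power_one_over field_simps)
  then show ?thesis using e n by fastforce
qed

text \<open>\<open>g\<close> is a limit of elements \<open>h = w * adj w\<close> with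
  \<open>w * e = w\<close>. The trace property gives
  \<open>\<tau> h = \<tau> (adj w * w * e)\<close>, and Cauchy--Schwarz bounds its square by
  \<open>\<tau> (h * h)\<close> times \<open>\<tau> (e * e)\<close>. In the limit
  \<open>\<tau> (g * g) \<le> \<tau> g\<close> allows one factor to be cancelled.\<close>

lemma (in subalgebra_trace) trace_le_of_cuntz_subequiv:
  assumes g: "cstar_le D 0 g" "cstar_le D g 1" "g \<in> D"
    and z: "z \<in> D" and e: "e \<in> D" "adj e = e" "z * e = z"
    and sub: "cuntz_subequiv D g (z * adj z)"
  shows "Re (\<tau> g) \<le> Re (\<tau> (e * e))"
proof -
  obtain v where v: "\<And>n. v n \<in> D" "(\<lambda>n. v n * (z * adj z) * adj (v n)) \<longlonglongrightarrow> g"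
    using sub unfolding cuntz_subequiv_def by blast
  define w where "w n = v n * z" for n
  have w: "w n \<in> D" "w n * e = w n" for n
    using v(1) z e by (simp_all add: w_def mult.assoc)
  have lim: "(\<lambda>n. w n * adj (w n)) \<longlonglongrightarrow> g"
    using v(2) by (simp add: w_def adj_mult mult.assoc)
  define h where "h n = w n * adj (w n)" for n
  have h: "h n \<in> D" "h \<longlonglongrightarrow> g" for n
    using w lim by (simp_all add: h_def[abs_def])
  have le: "(cmod (\<tau> (h n)))\<^sup>2 \<le> Re (\<tau> (h n * h n)) * Re (\<tau> (e * e))" for n
  proof -
    let ?k = "adj (w n) * w n"
    have "\<tau> (h n) = \<tau> (?k * e)"
      using w[of n] tau_commute[of "w n" "adj (w n)"] by (simp add: h_def mult.assoc)
    moreover have "\<tau> (?k * ?k) = \<tau> (h n * h n)"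
      using w(1)[of n] tau_commute[of "adj (w n)" "w n * adj (w n) * w n"] by (simp add: h_def mult.assoc)
    ultimately show ?thesis
      using Cauchy_Schwarz[of ?k e] w(1)[of n] e by (simp add: adj_mult)
  qed
  have l1: "(\<lambda>n. (cmod (\<tau> (h n)))\<^sup>2) \<longlonglongrightarrow> (cmod (\<tau> g))\<^sup>2"
    using h g by (intro tendsto_intros tau_tendsto) auto
  have l2: "(\<lambda>n. Re (\<tau> (h n * h n)) * Re (\<tau> (e * e))) \<longlonglongrightarrow> Re (\<tau> (g * g)) * Re (\<tau> (e * e))"
    using h g by (intro tendsto_intros tau_tendsto) auto
  have "(cmod (\<tau> g))\<^sup>2 \<le> Re (\<tau> (g * g)) * Re (\<tau> (e * e))"
    by (rule LIMSEQ_le[OF l1 l2]) (use le in auto)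
  moreover have e0: "0 \<le> Re (\<tau> (e * e))"
    using Re_tau_star_square[OF e(1)] by (simp add: e)
  ultimately have "(cmod (\<tau> g))\<^sup>2 \<le> Re (\<tau> g) * Re (\<tau> (e * e))"
    using tau_unit_interval_square[OF g] by (meson mult_right_mono order_trans)
  moreover have "(Re (\<tau> g))\<^sup>2 \<le> (cmod (\<tau> g))\<^sup>2"
    by (simp add: cmod_power2)
  ultimately have "Re (\<tau> g) * Re (\<tau> g) \<le> Re (\<tau> g) * Re (\<tau> (e * e))"
    by (simp add: power2_eq_square)
  \<comment> \<open>If \<open>Re (\<tau> g)\<close> is not positive, the nonnegative right-hand side
    dominates it anyway.\<close>
  then show ?thesis
    using e0 by (cases "0 < Re (\<tau> g)") auto
qed

lemma large_subalgebra_unital: "large_subalgebra B \<Longrightarrow> unital_subalgebra B"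
  by (simp add: large_subalgebra_def)

lemma large_subalgebraD:
  fixes a :: "nat \<Rightarrow> 'a::unital_cstar_algebra"
  assumes "large_subalgebra B" "m \<ge> 1" "\<epsilon> > 0" "x \<in> positives UNIV" "norm x = 1"
    "y \<in> positives B" "y \<noteq> 0"
  shows "\<exists>c g. g \<in> B \<and> cstar_le B 0 g \<and> cstar_le B g 1 \<and> (\<forall>j\<in>{1..m}. norm (c j - a j) < \<epsilon>) \<and>
      (\<forall>j\<in>{1..m}. (1 - g) * c j \<in> B) \<and> cuntz_subequiv B g y \<and> cuntz_subequiv UNIV g x \<and>
      norm ((1 - g) * x * (1 - g)) > 1 - \<epsilon>"
  using assms(1)[unfolded large_subalgebra_def, THEN conjunct2, rule_format, of m \<epsilon> x y a] assms(2-)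
  by blast

text \<open>\<open>c\<close> is real because star squares are self-adjoint. If it were negative,
  \<open>- c\<close> times \<open>p\<close> and \<open>adj z * z\<close> would be squares of
  commuting self-adjoint elements with sum 0. The C*-identity gives the modulus.\<close>

lemma star_square_scalar_projection:
  fixes p z :: "'a::unital_cstar_algebra"
  assumes p: "adj p = p" "p * p = p" "p \<noteq> 0" and z: "adj z * z = c *\<^sub>C p"
  shows "c = of_real ((norm z)\<^sup>2)"
proof -
  have "norm p * norm p = norm p"
    using norm_selfadj_square[OF p(1)] p(2) by (simp add: power2_eq_square)
  then have np: "norm p = 1" using p(3) by simp
  have "cnj c *\<^sub>C p = c *\<^sub>C p"
    using adj_star_square[of z] by (simp add: z p)
  then have "(cnj c - c) *\<^sub>C p = 0"
    by (simp add: cstar_space.scale_left_diff_distrib)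
  then have "cnj c = c" using p(3) by simp
  then have "Im c = 0" by (simp add: complex_eq_iff)
  then obtain r where r: "c = of_real r"
    by (metis complex_is_Real_iff Reals_cases)
  have zr: "adj z * z = r *\<^sub>R p" by (simp add: z r scaleR_scaleC)
  obtain v where v: "is_root (adj z * z) v" using star_square_root by blast
  have "r \<ge> 0"
  proof (rule ccontr)
    assume "\<not> r \<ge> 0"
    then have "r < 0" by simp
    define q where "q = sqrt (- r) *\<^sub>R p"
    have "v * p = p * v" by (rule root_commute[OF v]) (simp add: zr)
    then have "(norm q)\<^sup>2 \<le> norm (q * q + v * v)"
      by (intro norm_le_norm_sum_squares) (simp_all add: q_def p root_adj[OF v])
    also have "q * q + v * v = 0"
      using \<open>r < 0\<close> by (simp add: root_square[OF v] zr q_def p)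
    finally show False using \<open>r < 0\<close> np by (simp add: q_def)
  qed
  moreover have "\<bar>r\<bar> = (norm z)\<^sup>2"
    using cstar_identity[of z] by (simp add: zr np)
  ultimately show ?thesis by (simp add: r)
qed

lemma limit_of_multiples:
  fixes p :: "'a::unital_cstar_algebra"
  assumes lim: "(\<lambda>n. c n *\<^sub>C p) \<longlonglongrightarrow> x"
  shows "\<exists>d. x = d *\<^sub>C p"
proof (cases "p = 0")
  case True
  then show ?thesis using lim by (simp add: LIMSEQ_const_iff)
next
  case False
  have "Cauchy c"
  proof (rule CauchyI)
    fix e :: real assume "e > 0"
    then have "e * norm p > 0" using False by simp
    then obtain M where M: "\<forall>m\<ge>M. \<forall>n\<ge>M. norm (c m *\<^sub>C p - c n *\<^sub>C p) < e * norm p"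
      using CauchyD[OF LIMSEQ_imp_Cauchy[OF lim]] by blast
    have "cmod (c m - c n) * norm p < e * norm p" if "m \<ge> M" "n \<ge> M" for m n
      using M that by (simp add: norm_scaleC flip: cstar_space.scale_left_diff_distrib)
    then show "\<exists>M. \<forall>m\<ge>M. \<forall>n\<ge>M. norm (c m - c n) < e"
      using False by (auto simp: mult_less_cancel_right)
  qed
  then obtain d where d: "c \<longlonglongrightarrow> d" using Cauchy_convergent convergentD by blast
  have "(\<lambda>n. norm (c n *\<^sub>C p - d *\<^sub>C p)) \<longlonglongrightarrow> 0"
    using tendsto_mult_left_zero[OF tendsto_norm_zero[OF LIM_zero[OF d]], of "norm p"]
    by (simp add: norm_scaleC flip: cstar_space.scale_left_diff_distrib)
  then have "(\<lambda>n. c n *\<^sub>C p) \<longlonglongrightarrow> d *\<^sub>C p"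
    by (rule LIM_zero_cancel[OF tendsto_norm_zero_cancel])
  then show ?thesis using LIMSEQ_unique[OF lim] by blast
qed

text \<open>With \<open>x = y = p\<close> in the definition of largeness, \<open>\<parallel>(1 - g) p (1 - g)\<parallel> > 1 - \<epsilon>\<close> forces \<open>p g\<close> to be
  small, so \<open>p a p\<close> is close to \<open>p (1 - g) c p\<close>, a multiple of \<open>p\<close>.\<close>

lemma minimal_projection_of_large:
  fixes B :: "'a::unital_cstar_algebra set"
  assumes large: "large_subalgebra B" and min: "minimal_projection B p"
  shows "\<exists>c. p * a * p = c *\<^sub>C p"
proof -
  have p: "p \<in> B" "p \<noteq> 0" "adj p = p" "p * p = p"
    and scalar: "\<And>b. b \<in> B \<Longrightarrow> \<exists>c. p * b * p = c *\<^sub>C p"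
    using min by (auto simp: minimal_projection_def)
  note B = large_subalgebra_unital[OF large]
  have "norm p * norm p = norm p"
    using norm_selfadj_square[OF p(3)] p(4) by (simp add: power2_eq_square)
  then have np: "norm p = 1" using p(2) by simp
  have pos: "p \<in> positives UNIV" "p \<in> positives B"
    using p unfolding positives_def by (metis (mono_tags, lifting) UNIV_I mem_Collect_eq)+
  have approx: "\<exists>c. norm (p * a * p - c *\<^sub>C p) \<le> \<epsilon> + sqrt \<epsilon> * (norm a + \<epsilon>)" if \<epsilon>: "\<epsilon> > 0" for \<epsilon>
  proof -
    obtain c g where g: "g \<in> B" "cstar_le B 0 g" "cstar_le B g 1"
      and c: "norm (c 1 - a) < \<epsilon>" "(1 - g) * c 1 \<in> B"
      and gp: "norm ((1 - g) * p * (1 - g)) > 1 - \<epsilon>"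
      using large_subalgebraD[OF large order_refl \<epsilon> pos(1) np pos(2) p(2), of "\<lambda>_. a"] by force
    have g': "adj g = g" by (rule unit_interval_adj[OF g(2,3)])
    obtain s r where s: "is_root g s" and r: "is_root (1 - g) r"
      using unit_interval_roots[OF g(2,3)] by blast
    have "s * g = g * s" by (rule root_commute[OF s]) simp
    then have rs: "r * s = s * r" by (intro root_commute[OF r]) (simp add: algebra_simps)
    \<comment> \<open>Compression by \<open>p\<close> acts like a state on \<open>B\<close>: a star
      square \<open>adj x * x\<close> receives the value
      \<open>(norm (x * p))\<^sup>2\<close>.\<close>
    have val: "\<exists>k\<ge>0. p * b * p = k *\<^sub>R p \<and> (norm (x * p))\<^sup>2 = k" if bx: "b \<in> B" "adj x * x = b" for b x
    proof -
      obtain k where k: "p * b * p = k *\<^sub>C p" using scalar[OF bx(1)] by blast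
      have "adj (x * p) * (x * p) = p * (adj x * x) * p"
        by (simp add: adj_mult p mult.assoc)
      then have "k = of_real ((norm (x * p))\<^sup>2)"
        using k bx(2) by (intro star_square_scalar_projection[OF p(3,4,2)]) simp
      then show ?thesis using k by (intro exI[of _ "(norm (x * p))\<^sup>2"]) (simp add: scaleR_scaleC)
    qed
    \<comment> \<open>The values at \<open>g\<close>, \<open>g * g\<close>, \<open>g - g * g\<close>
      and \<open>(1 - g) * (1 - g)\<close> are \<gamma>, \<sigma>, \<kappa> and \<mu>. From \<kappa>
      = \<gamma> - \<sigma> \<ge> 0 follows \<mu> = 1 - 2\<gamma> + \<sigma> \<le> 1 - \<sigma>,
      while \<mu> > 1 - \<epsilon>; so \<sigma> < \<epsilon>.\<close>
    obtain \<gamma> where \<gamma>: "p * g * p = \<gamma> *\<^sub>R p"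
      using val[of g s] g(1) root_adj[OF s] root_square[OF s] by auto
    obtain \<sigma> where \<sigma>: "p * (g * g) * p = \<sigma> *\<^sub>R p" "(norm (g * p))\<^sup>2 = \<sigma>"
      using val[of "g * g" g] g(1) g' B by (auto intro: subalg_mult)
    have "adj (r * s) * (r * s) = s * (r * r) * s"
      by (simp add: adj_mult root_adj[OF s] root_adj[OF r] mult.assoc)
    also have "\<dots> = s * s - s * s * (s * s)"
      unfolding root_square[OF r] root_square[OF s, symmetric] by (simp add: algebra_simps)
    also have "\<dots> = g - g * g"
      by (simp add: root_square[OF s])
    finally have "adj (r * s) * (r * s) = g - g * g" .
    moreover have "g - g * g \<in> B"
      using g(1) B by (intro subalg_intros)
    ultimately obtain \<kappa> where \<kappa>: "\<kappa> \<ge> 0" "p * (g - g * g) * p = \<kappa> *\<^sub>R p"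
      using val[of "g - g * g" "r * s"] by blast
    have "\<kappa> *\<^sub>R p = (\<gamma> - \<sigma>) *\<^sub>R p"
      using \<gamma> \<sigma>(1) \<kappa>(2) by (simp add: algebra_simps)
    then have "\<kappa> = \<gamma> - \<sigma>" using p(2) by simp
    obtain \<mu> where \<mu>: "p * ((1 - g) * (1 - g)) * p = \<mu> *\<^sub>R p" "(norm ((1 - g) * p))\<^sup>2 = \<mu>"
      using val[of "(1 - g) * (1 - g)" "1 - g"] g(1) g' B by (auto intro: subalg_intros)
    have "\<mu> *\<^sub>R p = (1 - (\<gamma> + \<gamma>) + \<sigma>) *\<^sub>R p"
      using \<gamma> \<sigma>(1) \<mu>(1) by (simp add: algebra_simps p) (simp flip: scaleR_add_left)
    then have "\<mu> = 1 - (\<gamma> + \<gamma>) + \<sigma>" using p(2) by simp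
    moreover have "(1 - g) * p * (1 - g) = ((1 - g) * p) * adj ((1 - g) * p)"
      using p g' by (simp add: adj_mult mult.assoc) (metis mult.assoc)
    then have "norm ((1 - g) * p * (1 - g)) = \<mu>"
      using norm_mult_adj[of "(1 - g) * p"] \<mu>(2) by simp
    ultimately have "\<sigma> < \<epsilon>"
      using gp \<kappa>(1) \<open>\<kappa> = \<gamma> - \<sigma>\<close> by linarith
    then have gp_small: "norm (p * g) \<le> sqrt \<epsilon>"
      using \<sigma>(2) norm_adj[of "g * p"] by (intro real_le_rsqrt) (simp add: adj_mult p g')
    \<comment> \<open>Split \<open>a\<close> as \<open>a - c 1\<close>, plus \<open>g * c 1\<close>,
      plus \<open>(1 - g) * c 1\<close>; only the last, an element of \<open>B\<close>, compresses
      to the multiple of \<open>p\<close>.\<close>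
    obtain d where d: "p * ((1 - g) * c 1) * p = d *\<^sub>C p" using scalar c(2) by blast
    have "p * a * p - d *\<^sub>C p = p * (a - c 1) * p + p * g * (c 1 * p)"
      unfolding d[symmetric] by (simp add: algebra_simps)
    also have "norm \<dots> \<le> norm (a - c 1) + norm (p * g) * norm (c 1)"
    proof (rule norm_triangle_mono)
      show "norm (p * (a - c 1) * p) \<le> norm (a - c 1)"
        using norm_mult_ineq[of "p * (a - c 1)" p] norm_mult_ineq[of p "a - c 1"] np by simp
      have "norm (c 1 * p) \<le> norm (c 1)"
        using norm_mult_ineq[of "c 1" p] np by simp
      then show "norm (p * g * (c 1 * p)) \<le> norm (p * g) * norm (c 1)"
        using norm_mult_ineq[of "p * g" "c 1 * p"] by (meson mult_left_mono norm_ge_zero order_trans)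
    qed
    also have "\<dots> \<le> \<epsilon> + sqrt \<epsilon> * (norm a + \<epsilon>)"
    proof (intro add_mono mult_mono gp_small)
      show "norm (a - c 1) \<le> \<epsilon>" using c(1) by (simp add: norm_minus_commute)
      show "norm (c 1) \<le> norm a + \<epsilon>"
        using c(1) norm_triangle_ineq2[of "c 1" a] by linarith
    qed (use \<epsilon> in auto)
    finally show ?thesis by blast
  qed
  define E where "E n = 1 / real (Suc n)" for n
  have "\<exists>c. norm (p * a * p - c *\<^sub>C p) \<le> E n + sqrt (E n) * (norm a + E n)" for n
    by (rule approx) (simp add: E_def)
  then obtain c where c: "\<And>n. norm (p * a * p - c n *\<^sub>C p) \<le> E n + sqrt (E n) * (norm a + E n)"
    by metis
  have "E \<longlonglongrightarrow> 0"
    unfolding E_def using LIMSEQ_inverse_real_of_nat by (simp add: inverse_eq_divide)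
  then have "(\<lambda>n. E n + sqrt (E n) * (norm a + E n)) \<longlonglongrightarrow> 0 + sqrt 0 * (norm a + 0)"
    by (intro tendsto_intros)
  then have "(\<lambda>n. E n + sqrt (E n) * (norm a + E n)) \<longlonglongrightarrow> 0"
    by (simp only: real_sqrt_zero mult_zero_left add_0_right)
  then have "(\<lambda>n. p * a * p - c n *\<^sub>C p) \<longlonglongrightarrow> 0"
    by (rule Lim_null_comparison[rotated]) (intro always_eventually allI c)
  then have "(\<lambda>n. p * a * p - (p * a * p - c n *\<^sub>C p)) \<longlonglongrightarrow> p * a * p - 0"
    by (rule tendsto_diff[OF tendsto_const])
  then have "(\<lambda>n. c n *\<^sub>C p) \<longlonglongrightarrow> p * a * p" by simp
  then show ?thesis by (rule limit_of_multiples)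
qed

section \<open>Finite dimensionality of a simple algebra with a one-dimensional corner\<close>

lemma left_inverse_near_one:
  fixes j :: "'a::{real_normed_algebra_1,banach}"
  assumes "norm (1 - j) < 1"
  shows "\<exists>s. j * s = 1"
proof -
  define x where "x = 1 - j"
  have x: "summable (\<lambda>n. x ^ n)"
    using complete_algebra_summable_geometric assms unfolding x_def by blast
  have "(\<Sum>n. x ^ n) = 1 + x * (\<Sum>n. x ^ n)"
    using suminf_split_head[OF x] suminf_mult[OF x, of x] by simp
  then have "j * (\<Sum>n. x ^ n) = 1"
    by (simp add: x_def algebra_simps)
  then show ?thesis by blast
qed

text \<open>By simplicity the closure of the algebraic ideal is everything, so the ideal has an
  element \<open>j\<close> near 1. A Neumann series solves \<open>j * s = 1\<close>, which places 1
  in the ideal itself, without closure.\<close>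

lemma simple_one_in_ideal_span:
  fixes p :: "'a::unital_cstar_algebra"
  assumes simple: "simple_algebra TYPE('a)" and p: "p \<noteq> 0"
  shows "1 \<in> cstar_space.span {a * p * b | a b. True}"
proof -
  define J where "J = cstar_space.span {a * p * b | a b. True}"
  have J: "cstar_space.subspace J" by (simp add: J_def)
  have left: "x * y \<in> J" if "y \<in> J" for x y
  proof -
    have "cstar_space.subspace {y. x * y \<in> J}"
      using J by (auto simp: cstar_space.subspace_def distrib_left mult_scaleC_right)
    moreover have "{a * p * b | a b. True} \<subseteq> {y. x * y \<in> J}"
      unfolding J_def by (auto intro!: cstar_space.span_base) (metis mult.assoc)
    ultimately show ?thesis
      using that cstar_space.span_minimal unfolding J_def by blast
  qed
  have right: "y * x \<in> J" if "y \<in> J" for x y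
  proof -
    have "cstar_space.subspace {y. y * x \<in> J}"
      using J by (auto simp: cstar_space.subspace_def distrib_right mult_scaleC_left)
    moreover have "{a * p * b | a b. True} \<subseteq> {y. y * x \<in> J}"
      unfolding J_def by (auto intro!: cstar_space.span_base) (metis mult.assoc)
    ultimately show ?thesis
      using that cstar_space.span_minimal unfolding J_def by blast
  qed
  have "closed_two_sided_ideal (closure J)"
    unfolding closed_two_sided_ideal_def cstar_space.subspace_def
  proof (intro conjI ballI allI)
    show "0 \<in> closure J"
      using J closure_subset cstar_space.subspace_0 by blast
    show "x + y \<in> closure J" if "x \<in> closure J" "y \<in> closure J" for x y
    proof -
      obtain f g where "\<forall>n. f n \<in> J" "f \<longlonglongrightarrow> x" "\<forall>n. g n \<in> J" "g \<longlonglongrightarrow> y"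
        using \<open>x \<in> closure J\<close> \<open>y \<in> closure J\<close> unfolding closure_sequential by blast
      then show ?thesis
        unfolding closure_sequential using J
        by (intro exI[of _ "\<lambda>n. f n + g n"]) (auto intro: tendsto_add cstar_space.subspace_add)
    qed
    show "c *\<^sub>C x \<in> closure J" if "x \<in> closure J" for c x
    proof -
      obtain f where "\<forall>n. f n \<in> J" "f \<longlonglongrightarrow> x"
        using \<open>x \<in> closure J\<close> unfolding closure_sequential by blast
      then show ?thesis
        unfolding closure_sequential using J
        by (intro exI[of _ "\<lambda>n. c *\<^sub>C f n"]) (auto intro: tendsto_scaleC cstar_space.subspace_scale)
    qed
    show "a * x \<in> closure J" "x * a \<in> closure J" if "x \<in> closure J" for a x
    proof -
      obtain f where "\<forall>n. f n \<in> J" "f \<longlonglongrightarrow> x"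
        using \<open>x \<in> closure J\<close> unfolding closure_sequential by blast
      then show "a * x \<in> closure J" "x * a \<in> closure J"
        unfolding closure_sequential using left right
        by (intro exI[of _ "\<lambda>n. a * f n"] exI[of _ "\<lambda>n. f n * a"]; auto intro: tendsto_mult)+
    qed
  qed auto
  moreover have "p \<in> closure J"
  proof -
    have "p = 1 * p * 1" by simp
    then have "p \<in> J" unfolding J_def by (intro cstar_space.span_base) blast
    then show ?thesis using closure_subset by blast
  qed
  ultimately have "closure J = UNIV"
    using simple p unfolding simple_algebra_def by blast
  then have "1 \<in> closure J" by simp
  then obtain j where j: "j \<in> J" "dist j 1 < 1"
    unfolding closure_approachable by (meson zero_less_one)
  then obtain s where "j * s = 1"
    using left_inverse_near_one[of j] by (auto simp: dist_norm norm_minus_commute)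
  then show ?thesis using right[OF j(1), of s] by (simp add: J_def)
qed

text \<open>Write 1 as a finite sum of terms \<open>a1 * p * b1\<close>. In the expansion of
  \<open>a = 1 * a * 1\<close> each term is a scalar multiple of some \<open>a1 * p * b2\<close>,
  and these finitely many elements do not depend on \<open>a\<close>.\<close>

lemma finite_dimensional_of_scalar_corner:
  fixes p :: "'a::unital_cstar_algebra"
  assumes simple: "simple_algebra TYPE('a)" and p: "p \<noteq> 0"
    and scalar: "\<And>a. \<exists>c. p * a * p = c *\<^sub>C p"
  shows "\<not> infinite_dimensional TYPE('a)"
proof -
  let ?S = "{a * p * b | a b. True}"
  \<comment> \<open>Maps with \<open>fin\<close> are closed under linear combinations, so minimality
    of the span, used in \<open>x\<close> and then in \<open>y\<close>, replaces explicit double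
    sums.\<close>
  define fin where "fin f \<longleftrightarrow> (\<exists>T. finite T \<and> (\<forall>a. f a \<in> cstar_space.span T))" for f :: "'a \<Rightarrow> 'a"
  have fin_zero: "fin (\<lambda>a. 0)"
    unfolding fin_def by (intro exI[of _ "{}"]) simp
  have fin_add: "fin (\<lambda>a. f a + g a)" if fg: "fin f" "fin g" for f g
  proof -
    obtain T U where TU: "finite T" "\<forall>a. f a \<in> cstar_space.span T"
      "finite U" "\<forall>a. g a \<in> cstar_space.span U"
      using fg unfolding fin_def by blast
    have "f a + g a \<in> cstar_space.span (T \<union> U)" for a
      using TU cstar_space.span_mono[of T "T \<union> U"] cstar_space.span_mono[of U "T \<union> U"]
      by (intro cstar_space.span_add) auto
    then show ?thesis using TU unfolding fin_def by (intro exI[of _ "T \<union> U"]) auto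
  qed
  have fin_scale: "fin (\<lambda>a. c *\<^sub>C f a)" if "fin f" for c f
    using that cstar_space.span_scale unfolding fin_def by blast
  have base: "fin (\<lambda>a. x * a * y)" if xy: "x \<in> ?S" "y \<in> ?S" for x y
  proof -
    obtain a1 b1 a2 b2 where x: "x = a1 * p * b1" and y: "y = a2 * p * b2" using xy by blast
    have "x * a * y \<in> cstar_space.span {a1 * p * b2}" for a
    proof -
      obtain c where "p * (b1 * a * a2) * p = c *\<^sub>C p" using scalar by blast
      then have "a1 * (p * (b1 * a * a2) * p) * b2 = c *\<^sub>C (a1 * p * b2)"
        by (simp add: mult_scaleC_left mult_scaleC_right)
      then have "x * a * y = c *\<^sub>C (a1 * p * b2)" by (simp add: x y mult.assoc)
      then show ?thesis by (simp add: cstar_space.span_base cstar_space.span_scale)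
    qed
    then show ?thesis unfolding fin_def by (intro exI[of _ "{a1 * p * b2}"]) auto
  qed
  have step: "fin (\<lambda>a. x * a * y)" if x: "x \<in> cstar_space.span ?S" and y: "y \<in> ?S" for x y
  proof -
    have "cstar_space.subspace {x. fin (\<lambda>a. x * a * y)}"
      using fin_zero fin_add fin_scale
      by (auto simp: cstar_space.subspace_def distrib_right mult_scaleC_left)
    moreover have "?S \<subseteq> {x. fin (\<lambda>a. x * a * y)}" using base y by blast
    ultimately show ?thesis using x cstar_space.span_minimal by blast
  qed
  have "fin (\<lambda>a. x * a * y)" if x: "x \<in> cstar_space.span ?S" and y: "y \<in> cstar_space.span ?S" for x y
  proof -
    have "cstar_space.subspace {y. fin (\<lambda>a. x * a * y)}"
      using fin_zero fin_add fin_scale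
      by (auto simp: cstar_space.subspace_def distrib_left mult_scaleC_right)
    moreover have "?S \<subseteq> {y. fin (\<lambda>a. x * a * y)}" using step x by blast
    ultimately show ?thesis using y cstar_space.span_minimal by blast
  qed
  from this[OF simple_one_in_ideal_span[OF simple p] simple_one_in_ideal_span[OF simple p]]
  show ?thesis unfolding fin_def infinite_dimensional_def by auto
qed

section \<open>Extension of traces\<close>

text \<open>\<open>left_approx B \<tau> a c g\<close>: \<open>(1 - g\<^sub>n) c\<^sub>n\<close> are elements of \<open>B\<close> at which \<open>\<tau>\<close> approximates the value at \<open>a\<close>
  of any extension of \<open>\<tau>\<close>.\<close>

definition left_approx ::
  "'a::unital_cstar_algebra set \<Rightarrow> ('a \<Rightarrow> complex) \<Rightarrow> 'a \<Rightarrow> (nat \<Rightarrow> 'a) \<Rightarrow> (nat \<Rightarrow> 'a) \<Rightarrow> bool" where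
  "left_approx B \<tau> a c g \<longleftrightarrow> c \<longlonglongrightarrow> a \<and> (\<lambda>n. Re (\<tau> (g n))) \<longlonglongrightarrow> 0 \<and>
     (\<forall>n. g n \<in> B \<and> cstar_le B 0 (g n) \<and> cstar_le B (g n) 1 \<and> (1 - g n) * c n \<in> B)"

definition right_approx ::
  "'a::unital_cstar_algebra set \<Rightarrow> ('a \<Rightarrow> complex) \<Rightarrow> 'a \<Rightarrow> (nat \<Rightarrow> 'a) \<Rightarrow> (nat \<Rightarrow> 'a) \<Rightarrow> bool" where
  "right_approx B \<tau> a d g \<longleftrightarrow> d \<longlonglongrightarrow> a \<and> (\<lambda>n. Re (\<tau> (g n))) \<longlonglongrightarrow> 0 \<and>
     (\<forall>n. g n \<in> B \<and> cstar_le B 0 (g n) \<and> cstar_le B (g n) 1 \<and> d n * (1 - g n) \<in> B)"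

lemma
  assumes "left_approx B \<tau> a c g"
  shows left_approx_tendsto: "c \<longlonglongrightarrow> a"
    and left_approx_trace: "(\<lambda>n. Re (\<tau> (g n))) \<longlonglongrightarrow> 0"
    and left_approx_unit: "\<And>n. cstar_le B 0 (g n)" "\<And>n. cstar_le B (g n) 1" "\<And>n. g n \<in> B"
    and left_approx_mem: "\<And>n. (1 - g n) * c n \<in> B"
  using assms unfolding left_approx_def by blast+

lemma
  assumes "right_approx B \<tau> a d g"
  shows right_approx_tendsto: "d \<longlonglongrightarrow> a"
    and right_approx_unit: "\<And>n. cstar_le B 0 (g n)" "\<And>n. cstar_le B (g n) 1" "\<And>n. g n \<in> B"
    and right_approx_mem: "\<And>n. d n * (1 - g n) \<in> B"
  using assms unfolding right_approx_def by blast+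

text \<open>With \<open>b = (1 - g) * c\<close> and \<open>b' = d * (1 - h)\<close>, the difference
  \<open>b - b'\<close> is \<open>b * h - g * b'\<close> plus
  \<open>(1 - g) * (c - d) * (1 - h)\<close>. The first two products are controlled by
  Cauchy--Schwarz, the third by its norm.\<close>

lemma (in subalgebra_trace) left_right_trace_diff:
  assumes g: "cstar_le D 0 g" "cstar_le D g 1" "g \<in> D"
    and h: "cstar_le D 0 h" "cstar_le D h 1" "h \<in> D"
    and c: "(1 - g) * c \<in> D" and d: "d * (1 - h) \<in> D"
  shows "cmod (\<tau> ((1 - g) * c) - \<tau> (d * (1 - h))) \<le>
    sqrt (Re (\<tau> h)) * norm c + norm (c - d) + sqrt (Re (\<tau> g)) * norm d"
proof -
  let ?b = "(1 - g) * c" and ?b' = "d * (1 - h)"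
  have bh: "?b * h \<in> D" "?b * (1 - h) \<in> D" "(1 - g) * ?b' \<in> D" "g * ?b' \<in> D"
    using g h c d by (simp_all del: mult.assoc)
  have "?b - ?b' = ?b * h + (?b * (1 - h) - (1 - g) * ?b') - g * ?b'"
    by (simp add: algebra_simps)
  then have "\<tau> ?b - \<tau> ?b' = \<tau> (?b * h) + \<tau> (?b * (1 - h) - (1 - g) * ?b') - \<tau> (g * ?b')"
    using bh c d by (metis subalg_add[OF D] subalg_diff[OF D] tau_add tau_diff)
  also have "cmod \<dots> \<le> cmod (\<tau> (?b * h)) + cmod (\<tau> (?b * (1 - h) - (1 - g) * ?b')) + cmod (\<tau> (g * ?b'))"
    by (meson norm_triangle_ineq norm_triangle_ineq4 add_right_mono order_trans)
  also have "\<dots> \<le> sqrt (Re (\<tau> h)) * norm c + norm (c - d) + sqrt (Re (\<tau> g)) * norm d"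
  proof (intro add_mono)
    have contr: "norm (1 - g) \<le> 1" "norm (1 - h) \<le> 1"
      using unit_interval_norm_compl g h by blast+
    have nb: "norm ?b \<le> norm c" "norm ?b' \<le> norm d"
      using norm_mult_ineq[of "1 - g" c] norm_mult_ineq[of d "1 - h"] contr
        mult_right_mono[of "norm (1 - g)" 1 "norm c"] mult_left_mono[of "norm (1 - h)" 1 "norm d"] by simp_all
    have h0: "0 \<le> Re (\<tau> h)" "0 \<le> Re (\<tau> g)"
      using tau_unit_interval_square g h by (meson order_trans)+
    show "cmod (\<tau> (?b * h)) \<le> sqrt (Re (\<tau> h)) * norm c"
      using tau_mult_right_le[OF h c] nb h0 by (meson mult_left_mono order_trans real_sqrt_ge_zero)
    show "cmod (\<tau> (g * ?b')) \<le> sqrt (Re (\<tau> g)) * norm d"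
      using tau_mult_left_le[OF g d] nb h0 by (meson mult_left_mono order_trans real_sqrt_ge_zero)
    have "?b * (1 - h) - (1 - g) * ?b' = (1 - g) * (c - d) * (1 - h)"
      by (simp add: algebra_simps)
    also have "norm \<dots> \<le> norm (1 - g) * norm (c - d) * norm (1 - h)"
      by (meson mult_right_mono norm_ge_zero norm_mult_ineq order_trans)
    also have "\<dots> \<le> 1 * norm (c - d) * 1"
      using contr by (intro mult_mono) auto
    finally have "norm (?b * (1 - h) - (1 - g) * ?b') \<le> norm (c - d)" by simp
    then show "cmod (\<tau> (?b * (1 - h) - (1 - g) * ?b')) \<le> norm (c - d)"
      using tau_norm_le[OF subalg_diff[OF D bh(2,3)]] by linarith
  qed
  finally show ?thesis .
qed

text \<open>One sequence \<open>g\<close> serves both \<open>a\<close> and \<open>b\<close>;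
  additivity of the extension rests on this.\<close>

locale approximable_trace = subalgebra_trace D \<tau> for D :: "'a::unital_cstar_algebra set" and \<tau> +
  assumes approximable: "\<exists>c d g. left_approx D \<tau> a c g \<and> left_approx D \<tau> b d g"
begin

lemma right_approx_exists: "\<exists>d g. right_approx D \<tau> a d g"
proof -
  obtain c g where cg: "left_approx D \<tau> (adj a) c g" using approximable by blast
  have "adj (c n) * (1 - g n) \<in> D" for n
  proof -
    have "adj ((1 - g n) * c n) \<in> D" using left_approx_mem[OF cg] by simp
    then show ?thesis
      using unit_interval_adj[OF left_approx_unit(1,2)[OF cg], of n] by (simp add: adj_mult)
  qed
  then have "right_approx D \<tau> a (\<lambda>n. adj (c n)) g"
    using cg tendsto_adj[OF left_approx_tendsto[OF cg]] unfolding right_approx_def left_approx_def by auto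
  then show ?thesis by blast
qed

lemma left_right_tendsto_diff:
  assumes L: "left_approx D \<tau> a c g" and R: "right_approx D \<tau> a d h"
  shows "(\<lambda>n. \<tau> ((1 - g n) * c n) - \<tau> (d n * (1 - h n))) \<longlonglongrightarrow> 0"
proof (rule Lim_null_comparison)
  let ?e = "\<lambda>n. sqrt (Re (\<tau> (h n))) * norm (c n) + norm (c n - d n) + sqrt (Re (\<tau> (g n))) * norm (d n)"
  have "?e \<longlonglongrightarrow> sqrt 0 * norm a + norm (a - a) + sqrt 0 * norm a"
    using L R by (intro tendsto_intros) (auto simp: left_approx_def right_approx_def)
  then show "?e \<longlonglongrightarrow> 0" by simp
  show "\<forall>\<^sub>F n in sequentially. cmod (\<tau> ((1 - g n) * c n) - \<tau> (d n * (1 - h n))) \<le> ?e n"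
    using L R by (intro always_eventually allI left_right_trace_diff) (auto simp: left_approx_def right_approx_def)
qed

text \<open>A bounded sequence of left values has a subsequence with a limit \<open>l\<close>.
  Comparison with it gives every right approximation the limit \<open>l\<close>, and comparison with
  a right one then gives it to every left approximation.\<close>

lemma common_limit_exists:
  "\<exists>l. (\<forall>c g. left_approx D \<tau> a c g \<longrightarrow> (\<lambda>n. \<tau> ((1 - g n) * c n)) \<longlonglongrightarrow> l) \<and>
       (\<forall>d h. right_approx D \<tau> a d h \<longrightarrow> (\<lambda>n. \<tau> (d n * (1 - h n))) \<longlonglongrightarrow> l)"
proof -
  obtain c g where cg: "left_approx D \<tau> a c g" using approximable by blast
  obtain d h where dh: "right_approx D \<tau> a d h" using right_approx_exists by blast
  have "bounded (range c)"
    using left_approx_tendsto[OF cg] convergent_imp_bounded by blast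
  then obtain K where K: "\<And>n. norm (c n) \<le> K" by (auto simp: bounded_iff)
  have "cmod (\<tau> ((1 - g n) * c n)) \<le> K" for n
  proof -
    have "norm ((1 - g n) * c n) \<le> norm (1 - g n) * norm (c n)" by (rule norm_mult_ineq)
    also have "\<dots> \<le> 1 * K"
      using K[of n] unit_interval_norm_compl[OF left_approx_unit(1,2)[OF cg], of n]
      by (intro mult_mono) auto
    finally show ?thesis
      using tau_norm_le[OF left_approx_mem[OF cg], of n] by simp
  qed
  then have "bounded (range (\<lambda>n. \<tau> ((1 - g n) * c n)))" by (auto simp: bounded_iff)
  then obtain l r where r: "strict_mono r" "(\<lambda>n. \<tau> ((1 - g (r n)) * c (r n))) \<longlonglongrightarrow> l"
    using bounded_imp_convergent_subsequence by (force simp: o_def)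
  have cgr: "left_approx D \<tau> a (c \<circ> r) (g \<circ> r)"
    using cg LIMSEQ_subseq_LIMSEQ[OF left_approx_tendsto[OF cg] r(1)]
      LIMSEQ_subseq_LIMSEQ[OF left_approx_trace[OF cg] r(1)] unfolding left_approx_def by (auto simp: o_def)
  have right: "(\<lambda>n. \<tau> (d n * (1 - h n))) \<longlonglongrightarrow> l" if "right_approx D \<tau> a d h" for d h
    using tendsto_diff[OF r(2) left_right_tendsto_diff[OF cgr that]] by simp
  have left: "(\<lambda>n. \<tau> ((1 - g n) * c n)) \<longlonglongrightarrow> l" if "left_approx D \<tau> a c g" for c g
    using tendsto_add[OF right[OF dh] left_right_tendsto_diff[OF that dh]] by simp
  show ?thesis using left right by blast
qed

definition ext :: "'a \<Rightarrow> complex" where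
  "ext a = (SOME l. (\<forall>c g. left_approx D \<tau> a c g \<longrightarrow> (\<lambda>n. \<tau> ((1 - g n) * c n)) \<longlonglongrightarrow> l) \<and>
       (\<forall>d h. right_approx D \<tau> a d h \<longrightarrow> (\<lambda>n. \<tau> (d n * (1 - h n))) \<longlonglongrightarrow> l))"

lemma
  shows ext_left: "left_approx D \<tau> a c g \<Longrightarrow> (\<lambda>n. \<tau> ((1 - g n) * c n)) \<longlonglongrightarrow> ext a"
    and ext_right: "right_approx D \<tau> a d h \<Longrightarrow> (\<lambda>n. \<tau> (d n * (1 - h n))) \<longlonglongrightarrow> ext a"
  using someI_ex[OF common_limit_exists[of a]] unfolding ext_def by blast+

lemma ext_add: "ext (a + b) = ext a + ext b"
proof -
  obtain c d g where c: "left_approx D \<tau> a c g" and d: "left_approx D \<tau> b d g"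
    using approximable by blast
  have "left_approx D \<tau> (a + b) (\<lambda>n. c n + d n) g"
    using c d by (auto simp: left_approx_def distrib_left intro: tendsto_add)
  moreover have "(\<lambda>n. \<tau> ((1 - g n) * (c n + d n))) \<longlonglongrightarrow> ext a + ext b"
    using tendsto_add[OF ext_left[OF c] ext_left[OF d]] left_approx_mem[OF c] left_approx_mem[OF d]
    by (simp add: distrib_left tau_add)
  ultimately show ?thesis
    using ext_left LIMSEQ_unique by blast
qed

lemma ext_scaleC: "ext (k *\<^sub>C a) = k * ext a"
proof -
  obtain c g where c: "left_approx D \<tau> a c g" using approximable by blast
  have "left_approx D \<tau> (k *\<^sub>C a) (\<lambda>n. k *\<^sub>C c n) g"
    using c by (auto simp: left_approx_def mult_scaleC_right intro: tendsto_scaleC)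
  moreover have "(\<lambda>n. \<tau> ((1 - g n) * (k *\<^sub>C c n))) \<longlonglongrightarrow> k * ext a"
    using tendsto_mult_left[OF ext_left[OF c], of k] left_approx_mem[OF c]
    by (simp add: mult_scaleC_right tau_scaleC)
  ultimately show ?thesis
    using ext_left LIMSEQ_unique by blast
qed

lemma ext_diff: "ext (a - b) = ext a - ext b"
  using ext_add[of "a - b" b] by (simp add: algebra_simps)

lemma ext_eq:
  assumes a: "a \<in> D"
  shows "ext a = \<tau> a"
proof -
  obtain c g where c: "left_approx D \<tau> a c g" using approximable by blast
  have g: "g n \<in> D" for n using left_approx_unit(3)[OF c] .
  have "left_approx D \<tau> a (\<lambda>n. a) g"
    using c a by (auto simp: left_approx_def)
  then have "(\<lambda>n. \<tau> ((1 - g n) * a)) \<longlonglongrightarrow> ext a" by (rule ext_left)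
  moreover have "(\<lambda>n. \<tau> (g n * a)) \<longlonglongrightarrow> 0"
  proof (rule Lim_null_comparison)
    have "(\<lambda>n. sqrt (Re (\<tau> (g n))) * norm a) \<longlonglongrightarrow> sqrt 0 * norm a"
      by (intro tendsto_intros left_approx_trace[OF c])
    then show "(\<lambda>n. sqrt (Re (\<tau> (g n))) * norm a) \<longlonglongrightarrow> 0" by simp
    show "\<forall>\<^sub>F n in sequentially. cmod (\<tau> (g n * a)) \<le> sqrt (Re (\<tau> (g n))) * norm a"
      by (intro always_eventually allI tau_mult_left_le left_approx_unit[OF c] a)
  qed
  then have "(\<lambda>n. \<tau> a - \<tau> (g n * a)) \<longlonglongrightarrow> \<tau> a - 0"
    by (intro tendsto_intros)
  then have "(\<lambda>n. \<tau> ((1 - g n) * a)) \<longlonglongrightarrow> \<tau> a"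
    using a g by (simp add: left_diff_distrib tau_diff)
  ultimately show ?thesis using LIMSEQ_unique by blast
qed

lemma ext_norm_le: "cmod (ext a) \<le> norm a"
proof -
  obtain c g where c: "left_approx D \<tau> a c g" using approximable by blast
  have "cmod (\<tau> ((1 - g n) * c n)) \<le> norm (c n)" for n
  proof -
    have "norm ((1 - g n) * c n) \<le> norm (1 - g n) * norm (c n)" by (rule norm_mult_ineq)
    also have "\<dots> \<le> 1 * norm (c n)"
      using unit_interval_norm_compl[OF left_approx_unit(1,2)[OF c], of n] by (intro mult_mono) auto
    finally show ?thesis
      using tau_norm_le[OF left_approx_mem[OF c], of n] by simp
  qed
  then show ?thesis
    by (intro LIMSEQ_le[OF tendsto_norm[OF ext_left[OF c]] tendsto_norm[OF left_approx_tendsto[OF c]]]) auto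
qed

lemma ext_tendsto: "x \<longlonglongrightarrow> a \<Longrightarrow> (\<lambda>n. ext (x n)) \<longlonglongrightarrow> ext a"
  by (rule LIM_zero_cancel, rule Lim_null_comparison[where g = "\<lambda>n. norm (x n - a)"])
     (auto simp: ext_norm_le tendsto_norm_zero LIM_zero simp flip: ext_diff)

text \<open>Right approximations of \<open>a\<close> are used, because multiplying them on the left
  by \<open>g\<close> in \<open>D\<close> yields right approximations of
  \<open>g * a\<close>.\<close>

lemma ext_mult_left_le:
  assumes g: "cstar_le D 0 g" "cstar_le D g 1" "g \<in> D"
  shows "cmod (ext (g * a)) \<le> sqrt (Re (\<tau> g)) * norm a"
proof -
  obtain d h where d: "right_approx D \<tau> a d h" using right_approx_exists by blast
  have dh: "d n * (1 - h n) \<in> D" for n using right_approx_mem[OF d] .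
  have "right_approx D \<tau> (g * a) (\<lambda>n. g * d n) h"
    using d g dh unfolding right_approx_def
    by (auto simp: mult.assoc intro!: tendsto_intros subalg_mult[OF D])
  then have l: "(\<lambda>n. cmod (\<tau> (g * d n * (1 - h n)))) \<longlonglongrightarrow> cmod (ext (g * a))"
    by (intro tendsto_norm ext_right)
  have r: "(\<lambda>n. sqrt (Re (\<tau> g)) * norm (d n)) \<longlonglongrightarrow> sqrt (Re (\<tau> g)) * norm a"
    by (intro tendsto_intros right_approx_tendsto[OF d])
  have "cmod (\<tau> (g * d n * (1 - h n))) \<le> sqrt (Re (\<tau> g)) * norm (d n)" for n
  proof -
    have "norm (d n * (1 - h n)) \<le> norm (d n) * norm (1 - h n)" by (rule norm_mult_ineq)
    also have "\<dots> \<le> norm (d n) * 1"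
      using unit_interval_norm_compl[OF right_approx_unit(1,2)[OF d], of n] by (intro mult_mono) auto
    finally have "sqrt (Re (\<tau> g)) * norm (d n * (1 - h n)) \<le> sqrt (Re (\<tau> g)) * norm (d n)"
      using tau_unit_interval_square[OF g] by (intro mult_left_mono) auto
    then show ?thesis
      using tau_mult_left_le[OF g dh[of n]] by (simp add: mult.assoc)
  qed
  then show ?thesis by (intro LIMSEQ_le[OF l r]) auto
qed

lemma ext_mult_right_le:
  assumes g: "cstar_le D 0 g" "cstar_le D g 1" "g \<in> D"
  shows "cmod (ext (a * g)) \<le> sqrt (Re (\<tau> g)) * norm a"
proof -
  obtain c h where c: "left_approx D \<tau> a c h" using approximable by blast
  have ch: "(1 - h n) * c n \<in> D" for n using left_approx_mem[OF c] .
  have "left_approx D \<tau> (a * g) (\<lambda>n. c n * g) h"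
    using c g ch unfolding left_approx_def
    by (auto simp flip: mult.assoc intro!: tendsto_intros subalg_mult[OF D])
  then have l: "(\<lambda>n. cmod (\<tau> ((1 - h n) * (c n * g)))) \<longlonglongrightarrow> cmod (ext (a * g))"
    by (intro tendsto_norm ext_left)
  have r: "(\<lambda>n. sqrt (Re (\<tau> g)) * norm (c n)) \<longlonglongrightarrow> sqrt (Re (\<tau> g)) * norm a"
    by (intro tendsto_intros left_approx_tendsto[OF c])
  have "cmod (\<tau> ((1 - h n) * (c n * g))) \<le> sqrt (Re (\<tau> g)) * norm (c n)" for n
  proof -
    have "norm ((1 - h n) * c n) \<le> norm (1 - h n) * norm (c n)" by (rule norm_mult_ineq)
    also have "\<dots> \<le> 1 * norm (c n)"
      using unit_interval_norm_compl[OF left_approx_unit(1,2)[OF c], of n] by (intro mult_mono) auto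
    finally have "sqrt (Re (\<tau> g)) * norm ((1 - h n) * c n) \<le> sqrt (Re (\<tau> g)) * norm (c n)"
      using tau_unit_interval_square[OF g] by (intro mult_left_mono) auto
    then show ?thesis
      using tau_mult_right_le[OF g ch[of n]] by (simp add: mult.assoc)
  qed
  then show ?thesis by (intro LIMSEQ_le[OF l r]) auto
qed

text \<open>With \<open>y = c * adj c\<close> the argument of \<tau> is
  \<open>(1 - g) * y * (1 - g) = y - g * y - (1 - g) * y * g\<close>; the last two terms vanish in
  the limit by the one-sided estimates for \<open>ext\<close>.\<close>

lemma trace_square_tendsto_ext:
  assumes c: "left_approx D \<tau> a c g"
  shows "(\<lambda>n. \<tau> ((1 - g n) * c n * adj ((1 - g n) * c n))) \<longlonglongrightarrow> ext (a * adj a)"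
proof -
  note g = left_approx_unit[OF c]
  define y where "y n = c n * adj (c n)" for n
  have y: "y \<longlonglongrightarrow> a * adj a"
    unfolding y_def by (intro tendsto_intros left_approx_tendsto[OF c])
  have small: "(\<lambda>n. sqrt (Re (\<tau> (g n))) * norm (y n)) \<longlonglongrightarrow> 0"
  proof -
    have "(\<lambda>n. sqrt (Re (\<tau> (g n))) * norm (y n)) \<longlonglongrightarrow> sqrt 0 * norm (a * adj a)"
      by (intro tendsto_intros left_approx_trace[OF c] y)
    then show ?thesis by simp
  qed
  have l1: "(\<lambda>n. ext (g n * y n)) \<longlonglongrightarrow> 0"
    by (rule Lim_null_comparison[OF _ small]) (intro always_eventually allI ext_mult_left_le g)
  have l2: "(\<lambda>n. ext ((1 - g n) * y n * g n)) \<longlonglongrightarrow> 0"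
  proof (rule Lim_null_comparison[OF _ small], intro always_eventually allI)
    fix n
    have "norm ((1 - g n) * y n) \<le> norm (1 - g n) * norm (y n)" by (rule norm_mult_ineq)
    also have "\<dots> \<le> 1 * norm (y n)"
      using unit_interval_norm_compl[OF g(1,2), of n] by (intro mult_mono) auto
    finally have "sqrt (Re (\<tau> (g n))) * norm ((1 - g n) * y n) \<le> sqrt (Re (\<tau> (g n))) * norm (y n)"
      using tau_unit_interval_square[OF g, of n] by (intro mult_left_mono) auto
    then show "cmod (ext ((1 - g n) * y n * g n)) \<le> sqrt (Re (\<tau> (g n))) * norm (y n)"
      using ext_mult_right_le[OF g, of "(1 - g n) * y n" n] by linarith
  qed
  have "\<tau> ((1 - g n) * c n * adj ((1 - g n) * c n)) = ext (y n) - ext (g n * y n) - ext ((1 - g n) * y n * g n)" for n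
  proof -
    have "(1 - g n) * c n * adj ((1 - g n) * c n) = (1 - g n) * y n * (1 - g n)"
      using unit_interval_adj[OF g(1,2), of n] by (simp add: adj_mult y_def mult.assoc)
    also have "\<dots> = y n - g n * y n - (1 - g n) * y n * g n"
      by (simp add: algebra_simps)
    finally have eq: "(1 - g n) * c n * adj ((1 - g n) * c n) = y n - g n * y n - (1 - g n) * y n * g n" .
    have "(1 - g n) * c n * adj ((1 - g n) * c n) \<in> D"
      by (intro subalg_mult[OF D left_approx_mem[OF c]] subalg_adj[OF D left_approx_mem[OF c]])
    from ext_eq[OF this] show ?thesis
      unfolding eq ext_diff by (rule sym)
  qed
  moreover have "(\<lambda>n. ext (y n) - ext (g n * y n) - ext ((1 - g n) * y n * g n)) \<longlonglongrightarrow> ext (a * adj a) - 0 - 0"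
    by (intro tendsto_intros ext_tendsto y l1 l2)
  ultimately show ?thesis by simp
qed

lemma ext_nonneg: "ext (a * adj a) \<in> \<real>\<^sub>\<ge>\<^sub>0"
proof -
  obtain c g where c: "left_approx D \<tau> a c g" using approximable by blast
  have "\<tau> ((1 - g n) * c n * adj ((1 - g n) * c n)) \<in> \<real>\<^sub>\<ge>\<^sub>0" for n
    using tau_star_square[of "adj ((1 - g n) * c n)"] left_approx_mem[OF c, of n] by (simp only: adj_adj subalg_adj[OF D])
  then show ?thesis
    using closed_sequentially[OF closed_nonneg_Reals_complex _ trace_square_tendsto_ext[OF c]] by blast
qed

text \<open>The trace property of \<open>\<tau>\<close> moves the factor \<open>1 - g\<close> from the outside of \<open>c c\<^sup>*\<close> to the inside of
  \<open>c\<^sup>* c\<close>, where it can be dropped because \<open>(1 - g)\<^sup>2 \<le> 1\<close>.\<close>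

lemma Re_ext_star_le: "Re (ext (a * adj a)) \<le> Re (ext (adj a * a))"
proof -
  obtain c g where c: "left_approx D \<tau> a c g" using approximable by blast
  note g = left_approx_unit[OF c]
  have "Re (\<tau> ((1 - g n) * c n * adj ((1 - g n) * c n))) \<le> Re (ext (adj (c n) * c n))" for n
  proof -
    let ?b = "(1 - g n) * c n"
    note b = left_approx_mem[OF c, of n]
    have sa: "adj (1 - g n) = 1 - g n"
      using unit_interval_adj[OF g(1,2), of n] by simp
    obtain q where q: "is_root (1 - (1 - g n) * (1 - g n)) q"
      using one_minus_square_root[OF sa unit_interval_norm_compl[OF g(1,2)]] by blast
    have "adj (c n) * c n - adj ?b * ?b = adj (c n) * (1 - (1 - g n) * (1 - g n)) * c n"
      by (simp only: adj_mult sa) (simp add: algebra_simps)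
    also have "\<dots> = adj (q * c n) * adj (adj (q * c n))"
      by (simp add: root_square[OF q, symmetric] adj_mult root_adj[OF q] mult.assoc)
    finally have "0 \<le> Re (ext (adj (c n) * c n - adj ?b * ?b))"
      using ext_nonneg[of "adj (q * c n)"] by (auto elim!: nonneg_Reals_cases)
    moreover have "ext (adj ?b * ?b) = \<tau> (?b * adj ?b)"
      using b by (simp only: ext_eq tau_commute subalg_adj[OF D] subalg_mult[OF D])
    ultimately show ?thesis by (simp add: ext_diff)
  qed
  moreover have "(\<lambda>n. Re (ext (adj (c n) * c n))) \<longlonglongrightarrow> Re (ext (adj a * a))"
    by (intro tendsto_intros ext_tendsto left_approx_tendsto[OF c])
  ultimately show ?thesis
    by (intro LIMSEQ_le[OF tendsto_Re[OF trace_square_tendsto_ext[OF c]]]) auto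
qed

lemma ext_star_commute: "ext (adj a * a) = ext (a * adj a)"
proof -
  have "Re (ext (adj a * a)) = Re (ext (a * adj a))"
    using Re_ext_star_le[of a] Re_ext_star_le[of "adj a"] by simp
  moreover have "Im (ext (adj a * a)) = 0" "Im (ext (a * adj a)) = 0"
    using ext_nonneg[of a] ext_nonneg[of "adj a"] by (auto elim!: nonneg_Reals_cases)
  ultimately show ?thesis by (simp add: complex_eq_iff)
qed

text \<open>Polarization: \<open>u + y\<close> gives the sum of the mixed terms, and
  \<open>u + \<i> *\<^sub>C y\<close> gives their difference.\<close>

lemma ext_commute: "ext (x * y) = ext (y * x)"
proof -
  define u where "u = adj x"
  have x: "adj u = x" by (simp add: u_def)
  have 1: "ext (x * y) + ext (adj y * u) = ext (u * adj y) + ext (y * x)"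
    using ext_star_commute[of "u + y"] ext_star_commute[of u] ext_star_commute[of y]
    by (simp add: x distrib_left distrib_right ext_add ac_simps)
  have 2: "\<i> * ext (x * y) - \<i> * ext (adj y * u) = - \<i> * ext (u * adj y) + \<i> * ext (y * x)"
    using ext_star_commute[of "u + \<i> *\<^sub>C y"] ext_star_commute[of u] ext_star_commute[of y]
    by (simp add: x distrib_left distrib_right left_diff_distrib right_diff_distrib ext_add ext_diff
        ext_scaleC mult_scaleC_left mult_scaleC_right ac_simps)
  have "\<i> * (ext (x * y) - ext (adj y * u)) = \<i> * (ext (y * x) - ext (u * adj y))"
    using 2 by (simp add: algebra_simps)
  then have "ext (x * y) - ext (adj y * u) = ext (y * x) - ext (u * adj y)"
    by simp
  then show ?thesis using 1 by (simp add: algebra_simps complex_eq_iff)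
qed

lemma ext_in_tracial_states: "ext \<in> tracial_states UNIV"
  unfolding tracial_states_def
  using ext_add ext_scaleC ext_commute ext_eq[OF D_intros(1)] tau_one ext_nonneg[of "adj _"]
  by (auto simp: positives_def)

lemma restrict_ext: "restrict ext D = \<tau>"
proof
  fix x
  show "restrict ext D x = \<tau> x"
    using trace by (cases "x \<in> D") (auto simp: ext_eq tracial_states_def extensional_def)
qed

end

section \<open>Approximations from largeness, and bijectivity of the restriction\<close>

lemma positives_mono: "D \<subseteq> E \<Longrightarrow> positives D \<subseteq> positives E"
  by (auto simp: positives_def)

lemma cstar_le_mono: "D \<subseteq> E \<Longrightarrow> cstar_le D a b \<Longrightarrow> cstar_le E a b"
  using positives_mono by (auto simp: cstar_le_def)

lemma restrict_tracial_state:
  assumes B: "unital_subalgebra B" and t: "t \<in> tracial_states UNIV"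
  shows "restrict t B \<in> tracial_states B"
proof -
  have "x \<in> positives B \<Longrightarrow> x \<in> B" for x
    using B by (auto simp: positives_def subalg_mult subalg_adj)
  then show ?thesis
    using t positives_mono[of B UNIV] B
    by (auto simp: tracial_states_def subalg_intros)
qed

text \<open>Without minimal projections in \<open>B\<close> there is an \<open>e\<close> with
  \<open>\<tau> (e * e)\<close> small and a nonzero \<open>z\<close> in its corner; any
  \<open>g\<close> Cuntz below \<open>z * adj z\<close> then has small trace.\<close>

lemma large_subalgebra_approximable:
  fixes B :: "'a::unital_cstar_algebra set"
  assumes inf: "infinite_dimensional TYPE('a)" and simple: "simple_algebra TYPE('a)"
    and large: "large_subalgebra B" and \<tau>: "\<tau> \<in> tracial_states B"
  shows "approximable_trace B \<tau>"
proof -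
  note B = large_subalgebra_unital[OF large]
  interpret subalgebra_trace B \<tau> by standard (rule B, rule \<tau>)
  have no_min: "\<nexists>p. minimal_projection B p"
    using minimal_projection_of_large[OF large] finite_dimensional_of_scalar_corner[OF simple] inf
    unfolding minimal_projection_def[of B] by (metis minimal_projection_def)
  have step: "\<exists>c d g. g \<in> B \<and> cstar_le B 0 g \<and> cstar_le B g 1 \<and> norm (c - a) < \<epsilon> \<and> norm (d - b) < \<epsilon> \<and>
      (1 - g) * c \<in> B \<and> (1 - g) * d \<in> B \<and> Re (\<tau> g) < \<epsilon>" if \<epsilon>: "\<epsilon> > 0" for \<epsilon> a b
  proof -
    obtain e where e: "e \<in> B" "adj e = e" "corner B e \<noteq> {0}" "Re (\<tau> (e * e)) < \<epsilon>"
      using small_local_unit[OF no_min \<epsilon>] by blast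
    have "0 \<in> corner B e" by (simp add: corner_def)
    then obtain z where z: "z \<in> B" "z * e = z" "z \<noteq> 0"
      using e(3) by (auto simp: corner_def)
    have y: "z * adj z \<in> positives B" "z * adj z \<noteq> 0"
    proof -
      show "z * adj z \<in> positives B"
        unfolding positives_def using z(1) by (auto intro!: exI[of _ "adj z"])
      show "z * adj z \<noteq> 0" using norm_mult_adj[of z] z(3) by auto
    qed
    have one: "(1::'a) \<in> positives UNIV"
      unfolding positives_def by (auto intro!: exI[of _ 1])
    obtain c g where g: "g \<in> B" "cstar_le B 0 g" "cstar_le B g 1" "cuntz_subequiv B g (z * adj z)"
      and c: "\<forall>j\<in>{1..2::nat}. norm (c j - (if j = 1 then a else b)) < \<epsilon>"
        "\<forall>j\<in>{1..2::nat}. (1 - g) * c j \<in> B"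
      \<comment> \<open>\<open>m = 2\<close> approximates \<open>a\<close> and \<open>b\<close> with
        a single \<open>g\<close>; the norm-one positive element is 1.\<close>
      using large_subalgebraD[OF large _ \<epsilon> one norm_one y, of 2 "\<lambda>j. if j = 1 then a else b"] by auto
    have small: "Re (\<tau> g) < \<epsilon>"
      using trace_le_of_cuntz_subequiv[OF g(2,3,1) z(1) e(1,2) z(2) g(4)] e(4) by simp
    show ?thesis
      by (rule exI[where x = "c 1"], rule exI[where x = "c 2"], rule exI[where x = g])
         (use g c small in \<open>auto dest: bspec[where x = 1] bspec[where x = 2]\<close>)
  qed
  show ?thesis
  proof
    fix a b
    have "\<forall>n. \<exists>c d g. g \<in> B \<and> cstar_le B 0 g \<and> cstar_le B g 1 \<and> norm (c - a) < inverse (real (Suc n)) \<and>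
        norm (d - b) < inverse (real (Suc n)) \<and> (1 - g) * c \<in> B \<and> (1 - g) * d \<in> B \<and>
        Re (\<tau> g) < inverse (real (Suc n))"
      by (intro allI step) simp
    then obtain c d g where cdg: "\<And>n. g n \<in> B \<and> cstar_le B 0 (g n) \<and> cstar_le B (g n) 1 \<and>
        norm (c n - a) < inverse (real (Suc n)) \<and> norm (d n - b) < inverse (real (Suc n)) \<and>
        (1 - g n) * c n \<in> B \<and> (1 - g n) * d n \<in> B \<and> Re (\<tau> (g n)) < inverse (real (Suc n))"
      by metis
    have null: "f \<longlonglongrightarrow> 0" if "\<And>n. norm (f n) < inverse (real (Suc n))" for f :: "nat \<Rightarrow> 'b::real_normed_vector"
      by (rule Lim_null_comparison[OF _ LIMSEQ_inverse_real_of_nat])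
        (intro always_eventually allI less_imp_le that)
    have "c \<longlonglongrightarrow> a" "d \<longlonglongrightarrow> b"
      using cdg by (auto intro!: LIM_zero_cancel null)
    moreover have "0 \<le> Re (\<tau> (g n))" for n
      using tau_unit_interval_square[of "g n"] cdg[of n] by linarith
    then have "(\<lambda>n. Re (\<tau> (g n))) \<longlonglongrightarrow> 0"
      using cdg by (intro null) simp
    ultimately show "\<exists>c d g. left_approx B \<tau> a c g \<and> left_approx B \<tau> b d g"
      using cdg unfolding left_approx_def by blast
  qed
qed

text \<open>Cauchy--Schwarz on the whole algebra makes \<open>t (g n * c n)\<close> tend to 0. The
  approximating values involve only the restriction of \<open>t\<close>, which therefore determines
  \<open>t a\<close>.\<close>

lemma tracial_state_eq_limit:
  assumes t: "t \<in> tracial_states UNIV" and L: "left_approx B (restrict t B) a c g"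
  shows "(\<lambda>n. restrict t B ((1 - g n) * c n)) \<longlonglongrightarrow> t a"
proof -
  interpret subalgebra_trace UNIV t
    by standard (rule unital_subalgebra_UNIV, rule t)
  note g = left_approx_unit[OF L]
  have "(\<lambda>n. t (g n * c n)) \<longlonglongrightarrow> 0"
  proof (rule Lim_null_comparison)
    have "(\<lambda>n. Re (t (g n))) \<longlonglongrightarrow> 0"
      using left_approx_trace[OF L] g(3) by simp
    then have "(\<lambda>n. sqrt (Re (t (g n))) * norm (c n)) \<longlonglongrightarrow> sqrt 0 * norm a"
      by (intro tendsto_intros left_approx_tendsto[OF L])
    then show "(\<lambda>n. sqrt (Re (t (g n))) * norm (c n)) \<longlonglongrightarrow> 0" by simp
    show "\<forall>\<^sub>F n in sequentially. cmod (t (g n * c n)) \<le> sqrt (Re (t (g n))) * norm (c n)"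
      by (intro always_eventually allI tau_mult_left_le cstar_le_mono[OF subset_UNIV g(1)]
          cstar_le_mono[OF subset_UNIV g(2)] UNIV_I)
  qed
  then have "(\<lambda>n. t (c n) - t (g n * c n)) \<longlonglongrightarrow> t a - 0"
    by (intro tendsto_diff tau_tendsto left_approx_tendsto[OF L]) auto
  then show ?thesis
    using left_approx_mem[OF L] by (simp add: left_diff_distrib tau_diff)
qed

theorem theorem6p2:
  fixes B :: "'a::unital_cstar_algebra set"
  assumes "infinite_dimensional TYPE('a)"
    and "simple_algebra TYPE('a)"
    and "large_subalgebra B"
  shows "bij_betw (\<lambda>\<tau>. restrict \<tau> B) (tracial_states (UNIV :: 'a set)) (tracial_states B)"
proof (rule bij_betwI')
  note B = large_subalgebra_unital[OF assms(3)]
  note approx = large_subalgebra_approximable[OF assms]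
  fix s t :: "'a \<Rightarrow> complex"
  assume s: "s \<in> tracial_states UNIV"
  show "restrict s B \<in> tracial_states B"
    by (rule restrict_tracial_state[OF B s])
  assume t: "t \<in> tracial_states UNIV"
  show "restrict s B = restrict t B \<longleftrightarrow> s = t"
  proof
    assume eq: "restrict s B = restrict t B"
    interpret approximable_trace B "restrict s B"
      by (rule approx) (rule restrict_tracial_state[OF B s])
    show "s = t"
    proof
      fix a
      obtain c g where L: "left_approx B (restrict s B) a c g" using approximable by blast
      \<comment> \<open>One approximation serves both traces, since it refers to their common
        restriction.\<close>
      show "s a = t a"
        using tracial_state_eq_limit[OF s L] tracial_state_eq_limit[OF t L[unfolded eq]]
        unfolding eq by (rule LIMSEQ_unique)
    qed
  qed simp
next
  fix \<tau> assume "\<tau> \<in> tracial_states B"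
  then interpret approximable_trace B \<tau>
    by (rule large_subalgebra_approximable[OF assms])
  show "\<exists>t\<in>tracial_states UNIV. \<tau> = restrict t B"
    using ext_in_tracial_states restrict_ext by metis
qed

end
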